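(* For each integer $h\ge2$, the limit $\gamma_h=\lim_{n\to\infty}a_h(n)/b_h(n)$ satisfies $\gamma_h>1$. Furthermore, $$\lim_{h\to\infty}\gamma_h=\frac{\log 4}{\log 3}.$$
   Context: A partition $\lambda=(\lambda_1\ge\lambda_2\ge\dots\ge\lambda_\ell>0)$ of $n$ is drawn as its Ferrers diagram: left-adjusted rows of boxes, with $\lambda_i$ boxes in row $i$. The hook number of the box in row $i$ and column $j$ is the number of boxes in the L-shape consisting of that box, all boxes to its right in the same row, and all boxes below it in the same column. $\mathcal H(\lambda)$ denotes the multiset of all hook numbers of $\lambda$. Let $\mathcal O(n)$ be the set of partitions of $n$ all of whose parts are odd and $\mathcal D(n)$ the set of partitions of $n$ whose parts are pairwise distinct. For integers $h\ge1$ and $n\ge0$, define $$a_h(n)=\sum_{\lambda\in\mathcal O(n)}\#\{x\in\mathcal H(\lambda):x=h\},\qquad b_h(n)=\sum_{\lambda\in\mathcal D(n)}\#\{x\in\mathcal H(\lambda):x=h\},$$ counted with multiplicity. The constant $\gamma_h$ is the limit $\lim_{n\to\infty}a_h(n)/b_h(n)$, which exists for every $h\ge1$. *)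

theory Defs
  imports Complex_Main "HOL-Library.Multiset"
begin

definition partitions_of :: "nat \<Rightarrow> nat list set" where
  "partitions_of n =
     {\<mu>. sorted_wrt (\<ge>) \<mu> \<and> (\<forall>p\<in>set \<mu>. 0 < p) \<and> sum_list \<mu> = n}"

definition odd_partitions :: "nat \<Rightarrow> nat list set" where
  "odd_partitions n = {\<mu>\<in>partitions_of n. \<forall>p\<in>set \<mu>. odd p}"

definition distinct_partitions :: "nat \<Rightarrow> nat list set" where
  "distinct_partitions n = {\<mu>\<in>partitions_of n. distinct \<mu>}"

text \<open>Boxes are pairs (row, column), both indexed from 0.\<close>

definition ferrers :: "nat list \<Rightarrow> (nat \<times> nat) set" where
  "ferrers \<mu> = {(i, j). i < length \<mu> \<and> j < \<mu> ! i}"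

definition hook :: "nat list \<Rightarrow> nat \<times> nat \<Rightarrow> (nat \<times> nat) set" where
  "hook \<mu> = (\<lambda>(i, j). {(k, l)\<in>ferrers \<mu>. (k = i \<and> j \<le> l) \<or> (i \<le> k \<and> l = j)})"

definition hook_number :: "nat list \<Rightarrow> nat \<times> nat \<Rightarrow> nat" where
  "hook_number \<mu> x = card (hook \<mu> x)"

definition hook_numbers :: "nat list \<Rightarrow> nat multiset" where
  "hook_numbers \<mu> = image_mset (hook_number \<mu>) (mset_set (ferrers \<mu>))"

definition hook_a :: "nat \<Rightarrow> nat \<Rightarrow> nat" where
  "hook_a h n = (\<Sum>\<mu>\<in>odd_partitions n. count (hook_numbers \<mu>) h)"

definition hook_b :: "nat \<Rightarrow> nat \<Rightarrow> nat" where
  "hook_b h n = (\<Sum>\<mu>\<in>distinct_partitions n. count (hook_numbers \<mu>) h)"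

text \<open>The value of \<^term>\<open>lim\<close> is meaningful only for a convergent sequence.\<close>

definition hook_gamma :: "nat \<Rightarrow> real" where
  "hook_gamma h = lim (\<lambda>n. real (hook_a h n) / real (hook_b h n))"

text \<open>
  The multisets and sums above range over finite sets, so none of them collapses
  to the default value for infinite index sets.
\<close>

lemma finite_ferrers: "finite (ferrers \<mu>)"
proof -
  have "ferrers \<mu> = (SIGMA i:{..<length \<mu>}. {..<\<mu> ! i})"
    by (auto simp: ferrers_def)
  then show ?thesis by simp
qed

lemma finite_partitions_of: "finite (partitions_of n)"
proof (rule finite_subset)
  have "length xs \<le> sum_list xs" if "\<forall>p\<in>set xs. 0 < p" for xs :: "nat list"
    using that by (induction xs) auto
  then show "partitions_of n \<subseteq> {xs. set xs \<subseteq> {..n} \<and> length xs \<le> n}"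
    by (auto simp: partitions_of_def member_le_sum_list)
  show "finite {xs. set xs \<subseteq> {..n} \<and> length xs \<le> n}"
    by (rule finite_lists_length_le) simp
qed

lemma finite_odd_partitions: "finite (odd_partitions n)"
  by (simp add: odd_partitions_def finite_partitions_of)

lemma finite_distinct_partitions: "finite (distinct_partitions n)"
  by (simp add: distinct_partitions_def finite_partitions_of)

end

theory Submission
  imports Defs "HOL-Analysis.Analysis" "HOL-Real_Asymp.Real_Asymp"
begin

text \<open>
  In a partition with distinct or odd parts, a hook of length \<open>h\<close> that starts in column \<open>j\<close> is
  determined by the multiplicities of the parts in a window \<open>{j + 1..j + l}\<close> with \<open>l \<le> h\<close>. Prescribing
  them multiplies \<open>Q(q) = \<Prod>(1 + q\<^sup>m) = \<Prod>1 / (1 - q\<^sup>2\<^sup>m\<^sup>-\<^sup>1)\<close> by a power of \<open>q\<close> and by factors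
  \<open>1 / (1 + q\<^sup>m)\<close> in the distinct case, \<open>1 - q\<^sup>m\<close> in the odd case. Instead of asymptotics for the
  coefficients \<open>d(n)\<close> of \<open>Q\<close>, it suffices that \<open>d\<close> is nondecreasing and \<open>d(n) = o(D(n))\<close> with
  \<open>D(n) = \<Sum>k\<le>n. d(k)\<close>: then \<open>\<Sum>m. d(n - c m - b)\<close> is asymptotic to \<open>D(n) / c\<close>, and after expanding
  the factors and summing over \<open>j\<close>, both \<open>a\<^sub>h(n) / D(n)\<close> and \<open>b\<^sub>h(n) / D(n)\<close> converge. The limits are
  \<open>\<alpha>\<^sub>h = (\<Sum>l=1..h. 1 / (h - l div 2)) / 2\<close>, the average of two consecutive partial sums of the
  alternating harmonic series, and \<open>\<beta>\<^sub>h\<close>, the integral over \<open>[0, 1]\<close> of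
  \<open>(1 - (- x / (1 + x)) ^ h) / (1 + 2 x)\<close>. For \<open>h \<ge> 2\<close> this gives \<open>\<alpha>\<^sub>h \<ge> 2 / 3 > \<beta>\<^sub>h\<close>, and the limits for
  \<open>h \<rightarrow> \<infinity>\<close> are \<open>ln 2\<close> and \<open>ln 3 / 2\<close>.
\<close>

section \<open>Counting partitions and Euler's identity\<close>

text \<open>On coefficient sequences this is multiplication by \<open>q ^ k\<close>. The guard
  matters: truncated subtraction would otherwise yield \<open>f 0\<close> for
  \<open>n < k\<close>.\<close>

definition shift :: "nat \<Rightarrow> (nat \<Rightarrow> nat) \<Rightarrow> nat \<Rightarrow> nat" where
  "shift k f n = (if k \<le> n then f (n - k) else 0)"

definition subset_count :: "nat set \<Rightarrow> nat \<Rightarrow> nat" where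
  "subset_count A n = card {S. finite S \<and> S \<subseteq> A \<and> \<Sum>S = n}"

definition mset_count :: "nat set \<Rightarrow> nat \<Rightarrow> nat" where
  "mset_count A n = card {M. set_mset M \<subseteq> A \<and> \<Sum>\<^sub># M = n}"

lemma finite_subsets_sum:
  assumes "0 \<notin> A"
  shows "finite {S. finite S \<and> S \<subseteq> A \<and> \<Sum>S = (n::nat)}"
proof (rule finite_subset)
  show "{S. finite S \<and> S \<subseteq> A \<and> \<Sum>S = n} \<subseteq> Pow {..n}"
    using member_le_sum[of _ _ "\<lambda>x. x"] by fastforce
qed simp

lemma finite_msets_sum:
  assumes "0 \<notin> A"
  shows "finite {M. set_mset M \<subseteq> A \<and> \<Sum>\<^sub># M = (n::nat)}"
proof (rule finite_subset)
  show "{M. set_mset M \<subseteq> A \<and> \<Sum>\<^sub># M = n} \<subseteq> mset ` partitions_of n"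
  proof
    fix M assume M: "M \<in> {M. set_mset M \<subseteq> A \<and> \<Sum>\<^sub># M = n}"
    have s: "sum_list (sorted_list_of_multiset M) = n"
      using M by (metis (mono_tags, lifting) mem_Collect_eq mset_sorted_list_of_multiset sum_mset_sum_list)
    have "rev (sorted_list_of_multiset M) \<in> partitions_of n"
      using M assms s unfolding partitions_of_def
      by (auto simp: sorted_wrt_rev intro: Nat.gr0I)
    moreover have "mset (rev (sorted_list_of_multiset M)) = M" by simp
    ultimately show "M \<in> mset ` partitions_of n" by (metis imageI)
  qed
qed (simp add: finite_partitions_of)

text \<open>Turns a bijection that splits off a fixed contribution \<open>k\<close> to the weight
  \<open>g\<close> into a shift of a counting function; for \<open>k > n\<close> both sides are
  \<open>0\<close>.\<close>

lemma card_shift: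
  assumes "bij_betw f {x \<in> X. g x + k = n} Y"
  shows "card Y = shift k (\<lambda>n. card {x \<in> X. g x = n}) n"
proof (cases "k \<le> n")
  case True
  then have "{x \<in> X. g x + k = n} = {x \<in> X. g x = n - k}" by auto
  with assms True show ?thesis by (simp add: shift_def bij_betw_same_card[symmetric])
next
  case False
  then have "{x \<in> X. g x + k = n} = {}" by auto
  with assms False show ?thesis using bij_betw_same_card[OF assms] by (simp add: shift_def)
qed

text \<open>Deleting the prescribed elements \<open>T\<close> leaves an arbitrary finite subset of
  \<open>A - W\<close> whose sum is smaller by \<open>\<Sum>T\<close>.\<close>

lemma subset_count_restrict:
  assumes "0 \<notin> A" "finite T" "T \<subseteq> W" "W \<subseteq> A"
  shows "card {S. finite S \<and> S \<subseteq> A \<and> \<Sum>S = n \<and> S \<inter> W = T} = shift (\<Sum>T) (subset_count (A - W)) n"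
proof -
  have "bij_betw (\<lambda>S. S \<union> T) {S \<in> {S. finite S \<and> S \<subseteq> A - W}. \<Sum>S + \<Sum>T = n}
     {S. finite S \<and> S \<subseteq> A \<and> \<Sum>S = n \<and> S \<inter> W = T}"
  proof (rule bij_betw_byWitness[where f' = "\<lambda>S. S - W"]; safe)
    fix S assume S: "finite S" "S \<subseteq> A - W"
    have "S \<inter> T = {}" using S assms by auto
    with S assms show "\<Sum>(S \<union> T) = \<Sum>S + \<Sum>T" by (simp add: sum.union_disjoint)
  next
    fix S assume S: "finite S" "T = S \<inter> W"
    have "S = (S - W) \<union> (S \<inter> W)" by auto
    then show "\<Sum>(S - W) + \<Sum>(S \<inter> W) = \<Sum>S"
      by (metis S(1) sum.Int_Diff add.commute)
  qed (use assms in auto)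
  from card_shift[OF this] show ?thesis by (simp add: subset_count_def[abs_def] conj_assoc)
qed

lemma subset_count_rec:
  assumes "0 \<notin> A" "m \<in> A"
  shows "subset_count A n = subset_count (A - {m}) n + shift m (subset_count (A - {m})) n"
proof -
  let ?X = "\<lambda>T. {S. finite S \<and> S \<subseteq> A \<and> \<Sum>S = n \<and> S \<inter> {m} = T}"
  have "{S. finite S \<and> S \<subseteq> A \<and> \<Sum>S = n} = ?X {} \<union> ?X {m}" by auto
  moreover have "card (?X {} \<union> ?X {m}) = card (?X {}) + card (?X {m})"
    by (rule card_Un_disjoint) (auto intro: finite_subset[OF _ finite_subsets_sum[OF assms(1), of n]])
  ultimately have "subset_count A n = card (?X {}) + card (?X {m})"
    unfolding subset_count_def by (simp only:)
  also have "card (?X {}) = subset_count (A - {m}) n"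
    using subset_count_restrict[of A "{}" "{m}" n] assms by (simp add: shift_def)
  also have "card (?X {m}) = shift m (subset_count (A - {m})) n"
    using subset_count_restrict[of A "{m}" "{m}" n] assms by simp
  finally show ?thesis .
qed

text \<open>The shifted term still allows \<open>m\<close>, since removing one copy may leave
  others. In terms of generating functions, excluding \<open>m\<close> multiplies by
  \<open>1 - q ^ m\<close>.\<close>

lemma mset_count_rec:
  assumes "0 \<notin> A" "m \<in> A"
  shows "mset_count A n = mset_count (A - {m}) n + shift m (mset_count A) n"
proof -
  let ?X = "{M. set_mset M \<subseteq> A - {m} \<and> \<Sum>\<^sub># M = n}"
  let ?Y = "{M. set_mset M \<subseteq> A \<and> \<Sum>\<^sub># M = n \<and> m \<in># M}"
  have "{M. set_mset M \<subseteq> A \<and> \<Sum>\<^sub># M = n} = ?X \<union> ?Y" by auto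
  moreover have "card (?X \<union> ?Y) = card ?X + card ?Y"
    by (rule card_Un_disjoint) (auto intro: finite_subset[OF _ finite_msets_sum[OF assms(1), of n]])
  ultimately have "mset_count A n = mset_count (A - {m}) n + card ?Y"
    unfolding mset_count_def by (simp only:)
  moreover have "bij_betw (add_mset m) {M \<in> {M. set_mset M \<subseteq> A}. \<Sum>\<^sub># M + m = n} ?Y"
    by (rule bij_betw_byWitness[where f' = "\<lambda>M. M - {#m#}"])
       (use assms in \<open>auto dest: in_diffD simp: sum_mset.remove\<close>)
  from card_shift[OF this] have "card ?Y = shift m (mset_count A) n"
    by (simp add: mset_count_def[abs_def])
  ultimately show ?thesis by simp
qed

lemma fps_subset_count:
  assumes "finite A" "0 \<notin> A"
  shows "Abs_fps (\<lambda>n. real (subset_count A n)) = (\<Prod>m\<in>A. 1 + fps_X ^ m)"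
  using assms
proof (induction A rule: finite_induct)
  case empty
  have "{S. finite S \<and> S \<subseteq> {} \<and> \<Sum>S = n} = (if n = 0 then {{}} else {})" for n :: nat by auto
  then show ?case by (simp add: fps_eq_iff subset_count_def)
next
  case (insert m A)
  have "insert m A - {m} = A" using insert by auto
  then have "Abs_fps (\<lambda>n. real (subset_count (insert m A) n)) = (1 + fps_X ^ m) * Abs_fps (\<lambda>n. real (subset_count A n))"
    using subset_count_rec[of "insert m A" m] insert.prems
    by (auto simp: fps_eq_iff shift_def distrib_right fps_X_power_mult_nth)
  with insert show ?case by simp
qed

lemma fps_mset_count:
  assumes "finite A" "0 \<notin> A"
  shows "Abs_fps (\<lambda>n. real (mset_count A n)) * (\<Prod>m\<in>A. 1 - fps_X ^ m) = 1"
  using assms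
proof (induction A rule: finite_induct)
  case empty
  have "{M. set_mset M \<subseteq> {} \<and> \<Sum>\<^sub># M = n} = (if n = 0 then {{#}} else {})" for n :: nat by auto
  then show ?case by (simp add: fps_eq_iff mset_count_def)
next
  case (insert m A)
  have "insert m A - {m} = A" using insert by auto
  then have "Abs_fps (\<lambda>n. real (mset_count (insert m A) n)) * (1 - fps_X ^ m) = Abs_fps (\<lambda>n. real (mset_count A n))"
    using mset_count_rec[of "insert m A" m] insert.prems
    by (auto simp: fps_eq_iff shift_def right_diff_distrib mult.commute[of _ "fps_X ^ m"] fps_X_power_mult_nth)
  with insert show ?case by (simp add: mult.assoc[symmetric])
qed

text \<open>Elements above \<open>n\<close> cannot occur in a sum equal to \<open>n\<close>, so an
  infinite set of parts can be cut down to a finite one, whose generating function is a finite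
  product.\<close>

lemma subset_count_cong:
  assumes "0 \<notin> A" "A \<inter> {..n} = B \<inter> {..n}"
  shows "subset_count A n = subset_count B n"
proof -
  have "S \<subseteq> {..n}" if "finite S" "\<Sum>S = n" for S
    using that member_le_sum[of _ S "\<lambda>x. x"] by fastforce
  then have "{S. finite S \<and> S \<subseteq> A \<and> \<Sum>S = n} = {S. finite S \<and> S \<subseteq> B \<and> \<Sum>S = n}"
    using assms by blast
  then show ?thesis by (simp add: subset_count_def)
qed

lemma mset_count_cong:
  assumes "A \<inter> {..n} = B \<inter> {..n}"
  shows "mset_count A n = mset_count B n"
proof -
  have "set_mset M \<subseteq> {..n}" if "\<Sum>\<^sub># M = n" for M
    using that by (auto simp: sum_mset.remove)
  then have "{M. set_mset M \<subseteq> A \<and> \<Sum>\<^sub># M = n} = {M. set_mset M \<subseteq> B \<and> \<Sum>\<^sub># M = n}"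
    using assms by blast
  then show ?thesis by (simp add: mset_count_def)
qed

text \<open>Euler's argument with finite products:
  \<open>(1 + q ^ m) * (1 - q ^ m) = 1 - q ^ (2 * m)\<close> for \<open>m \<le> n\<close> produces
  the even factors up to \<open>2 * n\<close>. Cancelling those up to \<open>n\<close> leaves
  \<open>?F\<close>, whose exponents exceed \<open>n\<close> and which therefore cannot affect the
  coefficient of \<open>q ^ n\<close>.\<close>

lemma euler_odd_distinct: "subset_count {0<..} n = mset_count {m. odd m} n"
proof -
  let ?P = "\<Prod>m\<in>{1..n}. 1 + fps_X ^ m :: real fps"
  let ?O = "\<Prod>m\<in>{m\<in>{1..n}. odd m}. 1 - fps_X ^ m :: real fps"
  let ?E = "\<Prod>m\<in>{m\<in>{1..n}. even m}. 1 - fps_X ^ m :: real fps"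
  let ?F = "\<Prod>m\<in>{m\<in>{n<..2*n}. even m}. 1 - fps_X ^ m :: real fps"
  have split: "(\<Prod>m\<in>{1..n}. 1 - fps_X ^ m :: real fps) = ?O * ?E"
    by (subst prod.union_disjoint[symmetric]) (auto intro!: prod.cong)
  have "?P * (?O * ?E) = (\<Prod>m\<in>{1..n}. 1 - fps_X ^ (2*m))"
    unfolding split[symmetric] prod.distrib[symmetric]
    by (simp add: algebra_simps power_add[symmetric] mult_2 mult_2_right)
  also have "\<dots> = (\<Prod>m\<in>{m\<in>{1..2*n}. even m}. 1 - fps_X ^ m)"
    by (rule prod.reindex_bij_witness[where i = "\<lambda>m. m div 2" and j = "\<lambda>m. 2*m"]) auto
  also have "{m\<in>{1..2*n}. even m} = {m\<in>{1..n}. even m} \<union> {m\<in>{n<..2*n}. even m}" by auto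
  also have "(\<Prod>m\<in>\<dots>. 1 - fps_X ^ m) = ?E * ?F"
    by (rule prod.union_disjoint) auto
  finally have eq: "?E * (?P * ?O) = ?E * ?F" by (simp only: ac_simps)
  have "?E \<noteq> 0"
  proof -
    have "fps_nth (1 - fps_X ^ m :: real fps) 0 = 1" if "m > 0" for m using that by simp
    then have "1 - fps_X ^ m \<noteq> (0 :: real fps)" if "m > 0" for m
      using that by (metis fps_zero_nth zero_neq_one)
    then show ?thesis by (subst prod_zero_iff) auto
  qed
  from mult_left_cancel[OF this] eq have PO: "?P * ?O = ?F" by (rule iffD1)
  have tail: "fps_nth ((\<Prod>m\<in>B. 1 - fps_X ^ m) * f) n = fps_nth f n"
    if "finite B" "B \<subseteq> {n<..}" for B and f :: "real fps"
    using that by (induction B arbitrary: f rule: finite_induct)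
      (auto simp: mult.assoc left_diff_distrib fps_X_power_mult_nth)
  let ?M = "Abs_fps (\<lambda>k. real (mset_count {m\<in>{1..n}. odd m} k))"
  have "?M * ?O = 1" by (rule fps_mset_count) auto
  then have "?P = ?P * (?M * ?O)" by (simp only: mult_1_right)
  also have "\<dots> = (?P * ?O) * ?M" by (simp only: ac_simps)
  also have "\<dots> = ?F * ?M" by (simp only: PO)
  finally have "fps_nth ?P n = fps_nth (?F * ?M) n" by (rule arg_cong)
  also have "\<dots> = fps_nth ?M n" by (rule tail) auto
  also have "?P = Abs_fps (\<lambda>k. real (subset_count {1..n} k))" by (rule fps_subset_count[symmetric]) auto
  finally have "subset_count {1..n} n = mset_count {m\<in>{1..n}. odd m} n"
    unfolding fps_nth_Abs_fps of_nat_eq_iff .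
  moreover have "subset_count {1..n} n = subset_count {0<..} n" by (rule subset_count_cong) auto
  moreover have "mset_count {m\<in>{1..n}. odd m} n = mset_count {m. odd m} n"
    by (rule mset_count_cong) (auto intro: Nat.gr0I simp: Suc_le_eq)
  ultimately show ?thesis by simp
qed

section \<open>Growth of the number of strict partitions\<close>

abbreviation strict_count :: "nat \<Rightarrow> nat" where
  "strict_count \<equiv> subset_count {0<..}"

lemma subset_count_mono:
  assumes "A \<subseteq> B" "0 \<notin> B"
  shows "subset_count A n \<le> subset_count B n"
  unfolding subset_count_def
  by (rule card_mono[OF finite_subsets_sum[OF assms(2)]]) (use assms in auto)

text \<open>Clear on the odd side of Euler's identity: adjoining a part \<open>1\<close> embeds the
  partitions of \<open>n\<close> into those of \<open>n + 1\<close>.\<close>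

lemma mono_strict_count: "mono strict_count"
proof (rule incseq_SucI)
  fix n
  show "strict_count n \<le> strict_count (Suc n)"
    using mset_count_rec[of "{m. odd m}" 1 "Suc n"] by (simp add: euler_odd_distinct shift_def)
qed

text \<open>Each subset \<open>B\<close> of \<open>{1..k}\<close> is completed to a strict partition
  of \<open>n\<close> by the single part \<open>n - \<Sum>B\<close>. That part exceeds
  \<open>k\<close>, so \<open>B\<close> can be read off again. The resulting growth beats every
  polynomial.\<close>

lemma strict_count_ge_power2:
  assumes "(k + 2)\<^sup>2 \<le> n"
  shows "2 ^ k \<le> strict_count n"
proof -
  have *: "\<Sum>B \<le> k * k" if "B \<subseteq> {1..k}" for B
  proof -
    have "\<Sum>B \<le> \<Sum>{1..k}" using that by (intro sum_mono2) auto
    also have "\<dots> \<le> (\<Sum>i\<in>{1..k}. k)" by (intro sum_mono) auto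
    finally show ?thesis by simp
  qed
  have kn: "k * k + k < n" using assms by (simp add: power2_eq_square)
  let ?f = "\<lambda>B. insert (n - \<Sum>B) B"
  have big: "k < n - \<Sum>B" if "B \<subseteq> {1..k}" for B using *[OF that] kn by simp
  have "inj_on ?f (Pow {1..k})"
  proof (rule inj_on_inverseI[where g = "\<lambda>S. S \<inter> {1..k}"])
    fix B assume "B \<in> Pow {1..k}"
    then show "?f B \<inter> {1..k} = B" using big[of B] by auto
  qed
  then have "2 ^ k = card (?f ` Pow {1..k})" by (simp add: card_image card_Pow)
  also have "\<dots> \<le> strict_count n"
    unfolding subset_count_def
  proof (rule card_mono[OF finite_subsets_sum], goal_cases)
    case 2
    show ?case
    proof (intro image_subsetI CollectI conjI)
      fix B assume "B \<in> Pow {1..k}"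
      then have B: "B \<subseteq> {1..k}" by simp
      then show fin: "finite (?f B)" by (auto intro: finite_subset)
      show "?f B \<subseteq> {0<..}" using B big[OF B] by auto
      have "n - \<Sum>B \<notin> B" using big[OF B] B by auto
      then show "\<Sum>(?f B) = n" using fin *[OF B] kn by simp
    qed
  qed simp
  finally show ?thesis .
qed

lemma strict_count_pos: "strict_count n > 0"
proof -
  have "strict_count 0 \<le> strict_count n" using mono_strict_count by (simp add: mono_def)
  moreover have "{S. finite S \<and> S \<subseteq> {0<..} \<and> \<Sum>S = (0::nat)} = {{}}"
  proof (intro equalityI subsetI)
    fix S assume S: "S \<in> {S. finite S \<and> S \<subseteq> {0<..} \<and> \<Sum>S = (0::nat)}"
    then have "\<forall>x\<in>S. x = 0" using sum_eq_0_iff[of S "\<lambda>x. x"] by blast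
    moreover from S have "S \<subseteq> {0<..}" by simp
    then have "\<forall>x\<in>S. x \<noteq> 0" by (simp add: subset_iff)
    ultimately show "S \<in> {{}}" by blast
  qed auto
  ultimately show ?thesis by (simp add: subset_count_def)
qed

text \<open>Summing the number of parts over all strict partitions of \<open>n\<close> counts each pair of a
  partition and a part once; deleting the part maps the pairs with part \<open>m\<close> injectively to
  strict partitions of \<open>n - m\<close>.\<close>

lemma sum_card_parts_le:
  "(\<Sum>S | finite S \<and> S \<subseteq> {0<..} \<and> \<Sum>S = n. card S) \<le> (\<Sum>k<n. strict_count k)"
proof -
  let ?D = "{S. finite S \<and> S \<subseteq> {0<..} \<and> \<Sum>S = n}"
  have fin: "finite ?D" by (rule finite_subsets_sum) auto
  have "card S = (\<Sum>m\<in>{1..n}. of_bool (m \<in> S))" if "S \<in> ?D" for S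
  proof -
    have "S \<subseteq> {1..n}" using that member_le_sum[of _ S "\<lambda>x. x"] by fastforce
    then have "{1..n} \<inter> S = S" by auto
    then show ?thesis by simp
  qed
  then have "(\<Sum>S\<in>?D. card S) = (\<Sum>S\<in>?D. \<Sum>m\<in>{1..n}. of_bool (m \<in> S))" by (intro sum.cong) auto
  also have "\<dots> = (\<Sum>m\<in>{1..n}. \<Sum>S\<in>?D. of_bool (m \<in> S))" by (rule sum.swap)
  also have "\<dots> \<le> (\<Sum>m\<in>{1..n}. strict_count (n - m))"
  proof (rule sum_mono)
    fix m assume m: "m \<in> {1..n}"
    have "(\<Sum>S\<in>?D. of_bool (m \<in> S) :: nat) = card {S. finite S \<and> S \<subseteq> {0<..} \<and> \<Sum>S = n \<and> S \<inter> {m} = {m}}"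
      using fin by (auto simp: Int_def intro!: arg_cong[where f = card])
    also have "\<dots> = subset_count ({0<..} - {m}) (n - m)"
      using m by (subst subset_count_restrict) (auto simp: shift_def)
    also have "\<dots> \<le> strict_count (n - m)" by (rule subset_count_mono) auto
    finally show "(\<Sum>S\<in>?D. of_bool (m \<in> S)) \<le> strict_count (n - m)" .
  qed
  also have "\<dots> = (\<Sum>k<n. strict_count k)"
    by (rule sum.reindex_bij_witness[where i = "\<lambda>k. n - k" and j = "\<lambda>m. n - m"]) auto
  finally show ?thesis .
qed

lemma card_small_subsets:
  "card {S. S \<subseteq> {1..n} \<and> card S < K} \<le> K * (n + 1) ^ K"
proof -
  have "{S. S \<subseteq> {1..n} \<and> card S < K} = (\<Union>i<K. {S. S \<subseteq> {1..n} \<and> card S = i})" by auto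
  also have "card \<dots> \<le> (\<Sum>i<K. card {S. S \<subseteq> {1..n} \<and> card S = i})" by (rule card_UN_le) simp
  also have "\<dots> \<le> (\<Sum>i<K. (n + 1) ^ K)"
  proof (rule sum_mono)
    fix i assume "i \<in> {..<K}"
    have "card {S. S \<subseteq> {1..n} \<and> card S = i} = n choose i" using n_subsets[of "{1..n}" i] by simp
    also have "\<dots> \<le> (n + 1) ^ i"
    proof (cases "i \<le> n")
      case True
      then show ?thesis using binomial_le_pow[of i n] power_mono[of n "n+1" i] by simp
    qed (simp add: binomial_eq_0)
    also have "\<dots> \<le> (n + 1) ^ K" using \<open>i \<in> _\<close> by (intro power_increasing) auto
    finally show "card {S. S \<subseteq> {1..n} \<and> card S = i} \<le> (n + 1) ^ K" .
  qed
  finally show ?thesis by simp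
qed

text \<open>A partition with at least \<open>K\<close> parts pays for \<open>K\<close> by its number
  of parts; those with fewer than \<open>K\<close> parts are polynomially few. As \<open>K\<close>
  is arbitrary, this will force \<open>d(n) = o(D(n))\<close>.\<close>

lemma strict_count_mult_le:
  "K * strict_count n \<le> (\<Sum>k\<le>n. strict_count k) + K * (K * (n + 1) ^ K)"
proof -
  let ?D = "{S. finite S \<and> S \<subseteq> {0<..} \<and> \<Sum>S = n}"
  have fin: "finite ?D" by (rule finite_subsets_sum) auto
  have "K * strict_count n = (\<Sum>S\<in>?D. K)" by (simp add: subset_count_def)
  also have "\<dots> \<le> (\<Sum>S\<in>?D. card S + K * of_bool (card S < K))" by (rule sum_mono) auto
  also have "\<dots> = (\<Sum>S\<in>?D. card S) + K * card (?D \<inter> {S. card S < K})"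
    using fin by (simp add: sum.distrib sum_distrib_left[symmetric])
  also have "\<dots> \<le> (\<Sum>k\<le>n. strict_count k) + K * (K * (n + 1) ^ K)"
  proof (intro add_mono mult_left_mono)
    have "(\<Sum>k<n. strict_count k) \<le> (\<Sum>k\<le>n. strict_count k)" by (intro sum_mono2) auto
    with sum_card_parts_le show "(\<Sum>S\<in>?D. card S) \<le> (\<Sum>k\<le>n. strict_count k)"
      using order_trans by blast
    have "?D \<inter> {S. card S < K} \<subseteq> {S. S \<subseteq> {1..n} \<and> card S < K}"
      using member_le_sum[of _ _ "\<lambda>x. x"] by fastforce
    then have "card (?D \<inter> {S. card S < K}) \<le> card {S. S \<subseteq> {1..n} \<and> card S < K}"
      by (intro card_mono) auto
    also note card_small_subsets
    finally show "card (?D \<inter> {S. card S < K}) \<le> K * (n + 1) ^ K" .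
  qed auto
  finally show ?thesis .
qed

definition strict_sum :: "nat \<Rightarrow> real" where
  "strict_sum n = (\<Sum>k\<le>n. real (strict_count k))"

lemma strict_sum_pos: "strict_sum n > 0"
  unfolding strict_sum_def using strict_count_pos by (intro sum_pos) auto

lemma poly_over_strict_count: "(\<lambda>n. real (n + 1) ^ K / real (strict_count n)) \<longlonglongrightarrow> 0"
proof (rule tendsto_sandwich[OF _ _ tendsto_const])
  show "(\<lambda>n. real (n + 1) ^ K * 2 powr (3 - sqrt n)) \<longlonglongrightarrow> 0" by real_asymp
  show "\<forall>\<^sub>F n in sequentially. real (n + 1) ^ K / real (strict_count n) \<le> real (n + 1) ^ K * 2 powr (3 - sqrt n)"
  proof (rule eventually_sequentiallyI)
    fix n :: nat assume "4 \<le> n"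
    \<comment> \<open>The largest \<open>k\<close> with \<open>(k + 2)\<^sup>2 \<le> n\<close>. The
      bound \<open>4 \<le> n\<close> makes the subtraction exact, and rounding down costs less than
      \<open>1\<close>, hence the exponent \<open>sqrt n - 3\<close>.\<close>
    define k where "k = nat \<lfloor>sqrt n\<rfloor> - 2"
    have "sqrt n \<ge> 2" using \<open>4 \<le> n\<close> by (simp add: real_le_rsqrt)
    then have "\<lfloor>sqrt n\<rfloor> \<ge> 2" by linarith
    then have k: "real k + 2 = \<lfloor>sqrt n\<rfloor>" unfolding k_def by linarith
    then have "real k + 2 \<le> sqrt n" by linarith
    then have "(real k + 2)\<^sup>2 \<le> n" by (metis of_nat_0_le_iff add_nonneg_nonneg real_sqrt_pow2 power_mono zero_le_numeral)
    then have "real ((k + 2)\<^sup>2) \<le> real n" by (simp add: add.commute)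
    then have "(k + 2)\<^sup>2 \<le> n" by (simp only: of_nat_le_iff)
    then have "real (2 ^ k) \<le> strict_count n" using strict_count_ge_power2 of_nat_le_iff by blast
    moreover have "2 powr (sqrt n - 3) \<le> 2 powr real k" using k by (intro powr_mono) linarith+
    moreover have "2 powr real k = real (2 ^ k)" by (simp add: powr_realpow)
    ultimately have "2 powr (sqrt n - 3) \<le> strict_count n" by linarith
    then have "1 / real (strict_count n) \<le> 1 / 2 powr (sqrt n - 3)"
      by (intro divide_left_mono) (use strict_count_pos in auto)
    also have "\<dots> = 2 powr (3 - sqrt n)" by (simp add: powr_minus_divide[symmetric])
    finally have "real (n + 1) ^ K * (1 / strict_count n) \<le> real (n + 1) ^ K * 2 powr (3 - sqrt n)"
      by (intro mult_left_mono) auto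
    then show "real (n + 1) ^ K / strict_count n \<le> real (n + 1) ^ K * 2 powr (3 - sqrt n)" by simp
  qed
qed auto

text \<open>For each \<open>K\<close>, dividing \<open>strict_count_mult_le\<close> by
  \<open>strict_count n\<close> gives \<open>K \<le> strict_sum n / strict_count n + o(1)\<close>,
  so this quotient tends to infinity.\<close>

lemma strict_count_over_sum: "(\<lambda>n. real (strict_count n) / strict_sum n) \<longlonglongrightarrow> 0"
proof (rule tendsto_0_le[where K = 1])
  have "filterlim (\<lambda>n. strict_sum n / strict_count n) at_top sequentially"
    unfolding filterlim_at_top
  proof
    fix Z :: real
    obtain K :: nat where K: "Z + 1 \<le> K" using real_arch_simple by blast
    have "(\<lambda>n. real (K * K) * (real (n + 1) ^ K / real (strict_count n))) \<longlonglongrightarrow> real (K * K) * 0"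
      by (intro tendsto_mult tendsto_const poly_over_strict_count)
    then have "\<forall>\<^sub>F n in sequentially. real (K * K) * (real (n + 1) ^ K / real (strict_count n)) < 1"
      by (rule order_tendstoD) simp
    then show "\<forall>\<^sub>F n in sequentially. Z \<le> strict_sum n / strict_count n"
    proof eventually_elim
      case (elim n)
      have "real (K * strict_count n) \<le> real ((\<Sum>k\<le>n. strict_count k) + K * (K * (n + 1) ^ K))"
        using strict_count_mult_le of_nat_le_iff by blast
      then have "K * real (strict_count n) \<le> strict_sum n + real (K * K) * real (n + 1) ^ K"
        by (simp add: strict_sum_def mult.assoc)
      then have "real K \<le> strict_sum n / strict_count n + real (K * K) * (real (n + 1) ^ K / real (strict_count n))"
        using strict_count_pos[of n] by (simp add: field_simps)
      with elim K show ?case by linarith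
    qed
  qed
  from tendsto_inverse_0_at_top[OF this]
  show "(\<lambda>n. inverse (strict_sum n / strict_count n)) \<longlonglongrightarrow> 0" .
qed simp

section \<open>Mean values\<close>

text \<open>The normaliser is the same for odd and for distinct parts, so it cancels in the quotient
  of the two hook counts.\<close>

definition has_mean :: "(nat \<Rightarrow> real) \<Rightarrow> real \<Rightarrow> bool" where
  "has_mean f L \<longleftrightarrow> (\<lambda>n. f n / strict_sum n) \<longlonglongrightarrow> L"

lemma has_mean_diff: "has_mean f K \<Longrightarrow> has_mean g L \<Longrightarrow> has_mean (\<lambda>n. f n - g n) (K - L)"
  unfolding has_mean_def diff_divide_distrib by (rule tendsto_diff)

lemma has_mean_sum:
  "(\<And>i. i \<in> I \<Longrightarrow> has_mean (f i) (L i)) \<Longrightarrow> has_mean (\<lambda>n. \<Sum>i\<in>I. f i n) (\<Sum>i\<in>I. L i)"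
  unfolding has_mean_def sum_divide_distrib by (rule tendsto_sum)

lemma shift_shift: "shift k (shift l f) n = shift (k + l) f n"
  by (auto simp: shift_def)

lemma shift_add: "shift k (\<lambda>n. f n + g n) n = shift k f n + shift k g n"
  by (auto simp: shift_def)

lemma shift_mono: "(\<And>n. f n \<le> g n) \<Longrightarrow> shift k f n \<le> shift k g n"
  by (auto simp: shift_def)

lemma strict_sum_split: "strict_sum n = strict_sum (n - b) + (\<Sum>k\<in>{n - b<..n}. real (strict_count k))"
proof -
  have "{..n} = {..n - b} \<union> {n - b<..n}" by auto
  moreover have "sum f ({..n - b} \<union> {n - b<..n}) = sum f {..n - b} + sum f {n - b<..n}" for f :: "nat \<Rightarrow> real"
    by (rule sum.union_disjoint) auto
  ultimately show ?thesis by (simp only: strict_sum_def)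
qed

lemma strict_sum_diff_le: "\<bar>strict_sum n - strict_sum (n - b)\<bar> \<le> b * strict_count n"
proof -
  note strict_sum_split[of n b]
  moreover have "(\<Sum>k\<in>{n - b<..n}. real (strict_count k)) \<le> (\<Sum>k\<in>{n - b<..n}. real (strict_count n))"
    by (intro sum_mono) (use mono_strict_count in \<open>auto simp: mono_def\<close>)
  moreover have "(\<Sum>k\<in>{n - b<..n}. real (strict_count n)) \<le> b * strict_count n"
    by (auto intro: mult_right_mono)
  moreover have "0 \<le> (\<Sum>k\<in>{n - b<..n}. real (strict_count k))" by (intro sum_nonneg) auto
  ultimately show ?thesis by linarith
qed

text \<open>\<open>shift\<close> vanishes once its first argument exceeds \<open>n\<close>, so a
  range of \<open>m\<close> that is too long does no harm.\<close>

lemma sum_shift_atMost: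
  assumes "c > 0" "n \<le> b + M"
  shows "(\<Sum>m\<le>M. real (shift (c * m + b) f n)) = (\<Sum>m\<in>{m. c * m + b \<le> n}. real (f (n - b - c * m)))"
proof -
  have "{m. c * m + b \<le> n} \<subseteq> {..M}"
  proof
    fix m assume "m \<in> {m. c * m + b \<le> n}"
    have "m \<le> c * m" using assms by simp
    also have "\<dots> \<le> M" using \<open>m \<in> _\<close> assms by simp
    finally show "m \<in> {..M}" by simp
  qed
  then show ?thesis
    by (intro sum.mono_neutral_cong_right) (auto simp: shift_def ac_simps)
qed

text \<open>\<open>s n\<close> runs through the arguments \<open>n\<close>, \<open>n - c\<close>,
  \<open>n - 2 * c\<close> and so on. By monotonicity each block of \<open>c\<close> consecutive
  values of \<open>strict_count\<close> lies between \<open>c\<close> copies of the neighbouring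
  progression terms; the induction peels off the top block.\<close>

lemma sum_strict_count_multiples:
  assumes "c > 0"
  defines "s \<equiv> \<lambda>n. \<Sum>m\<in>{m. c * m \<le> n}. real (strict_count (n - c * m))"
  shows "strict_sum n \<le> c * s n \<and> c * s n \<le> strict_sum n + c * strict_count n"
proof (induction n rule: less_induct)
  case (less n)
  let ?B = "\<Sum>k\<in>{n - c<..n}. real (strict_count k)"
  have B: "?B \<le> c * strict_count n"
  proof -
    have "?B \<le> (\<Sum>k\<in>{n - c<..n}. real (strict_count n))"
      by (intro sum_mono) (use mono_strict_count in \<open>auto simp: mono_def\<close>)
    also have "\<dots> \<le> c * strict_count n" by (auto intro: mult_right_mono)
    finally show ?thesis .
  qed
  show ?case
  proof (cases "n < c")
    case True
    have "{m. c * m \<le> n} = {0}"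
    proof (intro equalityI subsetI)
      fix m assume m: "m \<in> {m. c * m \<le> n}"
      show "m \<in> {0}"
      proof (rule ccontr)
        assume "m \<notin> {0}"
        then have "c \<le> c * m" by simp
        with m True show False by simp
      qed
    qed auto
    then have s: "s n = strict_count n" by (simp add: s_def)
    have "strict_sum n \<le> (\<Sum>k\<le>n. real (strict_count n))"
      unfolding strict_sum_def by (intro sum_mono) (use mono_strict_count in \<open>auto simp: mono_def\<close>)
    also have "\<dots> \<le> c * strict_count n" using True by (auto intro!: mult_right_mono)
    finally show ?thesis using s strict_sum_pos[of n] by simp
  next
    case False
    then have cn: "c \<le> n" by simp
    have fin: "finite {m. c * m \<le> n - c}"
    proof (rule finite_subset)
      show "{m. c * m \<le> n - c} \<subseteq> {..n}"
      proof
        fix m assume "m \<in> {m. c * m \<le> n - c}"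
        have "m \<le> c * m" using assms(1) by simp
        also have "\<dots> \<le> n" using \<open>m \<in> _\<close> by simp
        finally show "m \<in> {..n}" by simp
      qed
    qed simp
    have "{m. c * m \<le> n} = insert 0 (Suc ` {m. c * m \<le> n - c})"
    proof (intro equalityI subsetI)
      fix m assume "m \<in> {m. c * m \<le> n}"
      then show "m \<in> insert 0 (Suc ` {m. c * m \<le> n - c})" by (cases m) auto
    qed (use cn in auto)
    then have "s n = strict_count n + s (n - c)"
      using fin unfolding s_def by (simp add: sum.reindex)
    moreover note strict_sum_split[of n c]
    moreover have "c * strict_count (n - c) \<le> ?B"
    proof -
      have "c * strict_count (n - c) = (\<Sum>k\<in>{n - c<..n}. real (strict_count (n - c)))"
        using cn by simp
      also have "\<dots> \<le> ?B"
        by (intro sum_mono) (use mono_strict_count in \<open>auto simp: mono_def\<close>)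
      finally show ?thesis .
    qed
    ultimately show ?thesis using less.IH[of "n - c"] B cn assms(1) by (auto simp: algebra_simps)
  qed
qed

text \<open>Starting at \<open>n - b\<close> instead of \<open>n\<close> changes
  \<open>strict_sum\<close> by at most \<open>b * strict_count n\<close>, and the comparison along
  the progression costs at most another \<open>c * strict_count n\<close>. Both are negligible
  against \<open>strict_sum n\<close>.\<close>

lemma has_mean_progression:
  assumes "c > 0"
  shows "has_mean (\<lambda>n. \<Sum>m\<le>n. real (shift (c * m + b) strict_count n)) (1 / c)"
  unfolding has_mean_def
proof (rule LIM_zero_cancel, rule tendsto_0_le[OF strict_count_over_sum])
  show "\<forall>\<^sub>F n in sequentially.
    norm ((\<Sum>m\<le>n. real (shift (c * m + b) strict_count n)) / strict_sum n - 1 / c)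
      \<le> norm (real (strict_count n) / strict_sum n) * ((b + c) / c)"
  proof (rule eventually_sequentiallyI)
    fix n assume n: "b \<le> n"
    define x where "x = (\<Sum>m\<le>n. real (shift (c * m + b) strict_count n))"
    have "x = (\<Sum>m\<in>{m. c * m + b \<le> n}. real (strict_count (n - b - c * m)))"
      unfolding x_def by (rule sum_shift_atMost) (use assms in auto)
    also have "{m. c * m + b \<le> n} = {m. c * m \<le> n - b}" using n by auto
    finally have "strict_sum (n - b) \<le> c * x" "c * x \<le> strict_sum (n - b) + c * strict_count (n - b)"
      using sum_strict_count_multiples[OF assms, of "n - b"] by simp_all
    moreover have "real c * real (strict_count (n - b)) \<le> real c * real (strict_count n)"
      using mono_strict_count by (intro mult_left_mono) (auto simp: mono_def)
    ultimately have "\<bar>c * x - strict_sum n\<bar> \<le> (b + c) * strict_count n"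
      using strict_sum_diff_le[of n b] by (simp add: algebra_simps)
    moreover have "x / strict_sum n - 1 / c = (c * x - strict_sum n) / (c * strict_sum n)"
      using assms strict_sum_pos[of n] by (simp add: field_simps)
    ultimately have "\<bar>x / strict_sum n - 1 / c\<bar> \<le> ((b + c) * strict_count n) / (c * strict_sum n)"
      using strict_sum_pos[of n] by (simp add: abs_mult divide_right_mono)
    then show "norm (x / strict_sum n - 1 / c) \<le> norm (real (strict_count n) / strict_sum n) * ((b + c) / c)"
      using strict_sum_pos[of n] by (simp add: abs_mult mult.commute)
  qed
qed

text \<open>Unrolling the recursion \<open>J\<close> times leaves an alternating sum of the
  \<open>Y j\<close> and the remainder \<open>R J\<close>, which lies between \<open>0\<close> and
  \<open>Z J\<close>. Choosing \<open>J\<close> first makes the mean of \<open>Z J\<close> small;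
  the finitely many other terms then converge.\<close>

lemma has_mean_alternating:
  assumes R: "\<And>j n. R j n = Y j n - R (Suc j) n" "\<And>j n. 0 \<le> R j n" "\<And>j n. R j n \<le> Z j n"
    and Y: "\<And>j. has_mean (Y j) (y j)" and Z: "\<And>j. has_mean (Z j) (z j)"
    and r: "\<And>j. r j = y j - r (Suc j)" "\<And>j. \<bar>r j\<bar> \<le> z j" and z: "z \<longlonglongrightarrow> 0"
  shows "has_mean (R 0) (r 0)"
  unfolding has_mean_def
proof (rule tendstoI)
  fix e :: real assume "e > 0"
  with z have "\<forall>\<^sub>F j in sequentially. z j < e / 2" by (intro order_tendstoD) auto
  then obtain J where J: "z J < e / 2" by (auto simp: eventually_sequentially)
  define E where "E n = (\<Sum>j<J. (-1) ^ j * (Y j n / strict_sum n - y j))" for n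
  have E: "R 0 n / strict_sum n - r 0 = E n + (-1) ^ J * (R J n / strict_sum n - r J)" for n
    unfolding E_def
  proof (induction J)
    case (Suc J)
    have step: "R J n / strict_sum n - r J = (Y J n / strict_sum n - y J) - (R (Suc J) n / strict_sum n - r (Suc J))"
      by (subst R(1)[of J n], subst r(1)[of J]) (simp add: diff_divide_distrib)
    show ?case unfolding Suc.IH step by (simp add: algebra_simps)
  qed simp
  have "E \<longlonglongrightarrow> (\<Sum>j<J. (-1) ^ j * (y j - y j))"
    unfolding E_def by (intro tendsto_intros) (use Y in \<open>auto simp: has_mean_def\<close>)
  moreover have "(\<lambda>n. Z J n / strict_sum n) \<longlonglongrightarrow> z J" using Z by (simp add: has_mean_def)
  ultimately have "(\<lambda>n. \<bar>E n\<bar> + Z J n / strict_sum n + z J) \<longlonglongrightarrow> \<bar>\<Sum>j<J. (-1) ^ j * (y j - y j)\<bar> + z J + z J"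
    by (intro tendsto_intros)
  then have "(\<lambda>n. \<bar>E n\<bar> + Z J n / strict_sum n + z J) \<longlonglongrightarrow> 2 * z J" by simp
  then have "\<forall>\<^sub>F n in sequentially. \<bar>E n\<bar> + Z J n / strict_sum n + z J < e"
    by (rule order_tendstoD) (use J in simp)
  then show "\<forall>\<^sub>F n in sequentially. dist (R 0 n / strict_sum n) (r 0) < e"
  proof eventually_elim
    case (elim n)
    have "0 \<le> R J n / strict_sum n" "R J n / strict_sum n \<le> Z J n / strict_sum n"
      using R(2,3)[of J n] strict_sum_pos[of n] by (simp_all add: divide_right_mono)
    then have "\<bar>R J n / strict_sum n - r J\<bar> \<le> Z J n / strict_sum n + z J" using r(2)[of J] by linarith
    moreover have "\<bar>R 0 n / strict_sum n - r 0\<bar> \<le> \<bar>E n\<bar> + \<bar>R J n / strict_sum n - r J\<bar>"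
      unfolding E by (rule order_trans[OF abs_triangle_ineq]) (simp add: abs_mult power_abs)
    ultimately show ?case using elim by (simp add: dist_real_def)
  qed
qed

section \<open>Window means for distinct parts\<close>

text \<open>As \<open>q\<close> tends to \<open>1\<close> from below, \<open>x = q ^ m\<close> makes
  \<open>1 - q\<close> times the sum over \<open>m\<close> of
  \<open>q ^ ((a + 1) * m) / (1 + q ^ m) ^ w\<close> a Riemann sum for this integral; the weight
  \<open>dx / x\<close> lowers the exponent by one.\<close>

definition window_integral :: "nat \<Rightarrow> nat \<Rightarrow> real" where
  "window_integral a w = integral {0..1} (\<lambda>x. x ^ a / (1 + x) ^ w)"

lemma window_integrable: "(\<lambda>x::real. x ^ a / (1 + x) ^ w) integrable_on {0..1}"
  by (intro integrable_continuous_real continuous_intros) auto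

lemma window_integral_0: "window_integral a 0 = 1 / (a + 1)"
proof -
  have "((\<lambda>x::real. x ^ a) has_integral 1 ^ Suc a / real (Suc a) - 0 ^ Suc a / real (Suc a)) {0..1}"
    by (rule fundamental_theorem_of_calculus[where f = "\<lambda>x. x ^ Suc a / real (Suc a)"])
       (auto simp: has_real_derivative_iff_has_vector_derivative[symmetric]
         simp del: power_Suc of_nat_Suc intro!: derivative_eq_intros)
  then show ?thesis by (simp add: window_integral_def integral_unique add.commute)
qed

text \<open>Follows from \<open>1 = (1 + x) - x\<close> and matches the counting recursion for one
  more excluded element of the window.\<close>

lemma window_integral_rec: "window_integral a (Suc w) = window_integral a w - window_integral (Suc a) (Suc w)"
proof -
  have "window_integral a (Suc w) + window_integral (Suc a) (Suc w) =
     integral {0..1} (\<lambda>x. x ^ a / (1 + x) ^ Suc w + x ^ Suc a / (1 + x) ^ Suc w)"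
    unfolding window_integral_def by (rule Henstock_Kurzweil_Integration.integral_add[symmetric])
      (rule window_integrable)+
  also have "\<dots> = window_integral a w"
    unfolding window_integral_def
  proof (rule integral_cong)
    fix x :: real assume "x \<in> {0..1}"
    then have "1 + x \<noteq> 0" by simp
    have "x ^ a / (1 + x) ^ Suc w + x ^ Suc a / (1 + x) ^ Suc w = x ^ a * (1 + x) / ((1 + x) ^ w * (1 + x))"
      by (simp add: add_divide_distrib[symmetric] algebra_simps)
    also have "\<dots> = x ^ a / (1 + x) ^ w"
      using \<open>1 + x \<noteq> 0\<close> by (rule nonzero_mult_divide_mult_cancel_right)
    finally show "x ^ a / (1 + x) ^ Suc w + x ^ Suc a / (1 + x) ^ Suc w = x ^ a / (1 + x) ^ w" .
  qed
  finally show ?thesis by simp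
qed

text \<open>Comparison with the case \<open>w = 0\<close>. The bound tends to \<open>0\<close> in
  \<open>a\<close> and thereby controls the remainder of the alternating expansion.\<close>

lemma window_integral_bounds: "\<bar>window_integral a w\<bar> \<le> 1 / (a + 1)"
proof -
  have "0 \<le> window_integral a w"
    unfolding window_integral_def by (rule Henstock_Kurzweil_Integration.integral_nonneg[OF window_integrable]) auto
  moreover have "window_integral a w \<le> window_integral a 0"
    unfolding window_integral_def
  proof (rule integral_le[OF window_integrable window_integrable])
    fix x :: real assume "x \<in> {0..1}"
    then have "1 \<le> (1 + x) ^ w" by (intro one_le_power) auto
    then show "x ^ a / (1 + x) ^ w \<le> x ^ a / (1 + x) ^ 0"
      using \<open>x \<in> _\<close> by (intro divide_left_mono) auto
  qed
  ultimately show ?thesis using window_integral_0[of a] by simp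
qed

text \<open>One element \<open>m + i\<close> of the window contributes the factor \<open>1 / (1 + q ^ (m + i))\<close> to the
  generating function. It is expanded as a geometric series, truncated with a remainder of known
  sign whose mean tends to \<open>0\<close>.\<close>

lemma has_mean_strict_window:
  assumes "finite W" "0 \<notin> W"
  shows "has_mean (\<lambda>n. \<Sum>m\<le>n. real (shift (Suc a * m + b) (subset_count ({0<..} - (+) m ` W)) n))
           (window_integral a (card W))"
  using assms
proof (induction W arbitrary: a b rule: finite_induct)
  case empty
  then show ?case using has_mean_progression[of "Suc a" b]
    by (simp add: window_integral_0 add.commute)
next
  case (insert i W)
  define X where "X V a b n = (\<Sum>m\<le>n. real (shift (Suc a * m + b) (subset_count ({0<..} - (+) m ` V)) n))"
    for V a b n
  \<comment> \<open>Partitions that avoid the translate of \<open>W\<close> either avoid or contain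
    \<open>m + i\<close>; deleting \<open>m + i\<close> from the latter raises \<open>a\<close> by
    one and \<open>b\<close> by \<open>i\<close>.\<close>
  have rec: "X (insert i W) a b n = X W a b n - X (insert i W) (Suc a) (b + i) n" for a b n
  proof -
    have "shift (Suc a * m + b) (subset_count ({0<..} - (+) m ` W)) n =
      shift (Suc a * m + b) (subset_count ({0<..} - (+) m ` insert i W)) n +
      shift (Suc (Suc a) * m + (b + i)) (subset_count ({0<..} - (+) m ` insert i W)) n" for m
    proof -
      let ?A = "{0<..} - (+) m ` W"
      have A: "?A - {m + i} = {0<..} - (+) m ` insert i W" by auto
      have "0 \<notin> ?A" "m + i \<in> ?A" using insert.prems insert.hyps by auto
      from subset_count_rec[OF this]
      have "subset_count ?A n = subset_count (?A - {m + i}) n + shift (m + i) (subset_count (?A - {m + i})) n" for n .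
      then have "shift (Suc a * m + b) (subset_count ?A) n = shift (Suc a * m + b)
        (\<lambda>n. subset_count (?A - {m + i}) n + shift (m + i) (subset_count (?A - {m + i})) n) n"
        by (simp add: shift_def)
      then show ?thesis unfolding A shift_add shift_shift by (simp add: algebra_simps)
    qed
    then show ?thesis by (simp add: X_def sum.distrib)
  qed
  have le: "X (insert i W) a b n \<le> X {} a b n" for a b n
    unfolding X_def of_nat_le_iff by (intro sum_mono) (auto intro!: shift_mono subset_count_mono)
  have zero: "has_mean (X {} a b) (1 / (a + 1))" for a b
    using has_mean_progression[of "Suc a" b] by (simp add: X_def[abs_def] add.commute)
  \<comment> \<open>The neutral terms exhibit the claim as the member \<open>j = 0\<close> of the
    family \<open>R\<close>.\<close>
  have "has_mean (X (insert i W) (a + 0) (b + 0 * i)) (window_integral (a + 0) (Suc (card W)))"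
  proof (rule has_mean_alternating[where R = "\<lambda>j. X (insert i W) (a + j) (b + j * i)"
        and Y = "\<lambda>j. X W (a + j) (b + j * i)" and Z = "\<lambda>j. X {} (a + j) (b + j * i)"
        and y = "\<lambda>j. window_integral (a + j) (card W)" and z = "\<lambda>j. 1 / (real (a + j) + 1)"
        and r = "\<lambda>j. window_integral (a + j) (Suc (card W))"])
    show "X (insert i W) (a + j) (b + j * i) n =
        X W (a + j) (b + j * i) n - X (insert i W) (a + Suc j) (b + Suc j * i) n" for j n
      using rec[of "a + j" "b + j * i" n] by (simp add: ac_simps)
    show "has_mean (X W (a + j) (b + j * i)) (window_integral (a + j) (card W))" for j
      using insert.IH insert.prems by (simp add: X_def[abs_def])
    show "(\<lambda>j. 1 / (real (a + j) + 1)) \<longlonglongrightarrow> 0" by real_asymp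
    show "0 \<le> X (insert i W) (a + j) (b + j * i) n" for j n unfolding X_def by (intro sum_nonneg) auto
    show "X (insert i W) (a + j) (b + j * i) n \<le> X {} (a + j) (b + j * i) n" for j n by (rule le)
    show "has_mean (X {} (a + j) (b + j * i)) (1 / (real (a + j) + 1))" for j using zero[of "a + j"] by simp
    show "window_integral (a + j) (Suc (card W)) =
        window_integral (a + j) (card W) - window_integral (a + Suc j) (Suc (card W))" for j
      using window_integral_rec[of "a + j"] by simp
    show "\<bar>window_integral (a + j) (Suc (card W))\<bar> \<le> 1 / (real (a + j) + 1)" for j
      using window_integral_bounds[of "a + j"] by simp
  qed
  then show ?case using insert.hyps by (simp add: X_def[abs_def])
qed

section \<open>Window means for odd parts\<close>

text \<open>The value \<open>a! k! / (a + k + 1)!\<close> of the integral of \<open>x ^ a * (1 - x) ^ k\<close> over \<open>[0, 1]\<close>.\<close>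

definition window_beta :: "nat \<Rightarrow> nat \<Rightarrow> real" where
  "window_beta a k = fact a * fact k / fact (a + k + 1)"

lemma window_beta_0: "window_beta a 0 = 1 / (a + 1)"
  by (simp add: window_beta_def)

text \<open>Corresponds to \<open>(1 - x) ^ (k + 1) = (1 - x) ^ k - x * (1 - x) ^ k\<close> under
  the integral.\<close>

lemma window_beta_rec: "window_beta a (Suc k) = window_beta a k - window_beta (Suc a) k"
proof -
  have eq: "a + Suc k + 1 = Suc (a + k + 1)" "Suc a + k + 1 = Suc (a + k + 1)" by simp_all
  define F :: real where "F = fact (a + k + 1)"
  have "F \<noteq> 0" by (simp add: F_def)
  then show ?thesis
    unfolding window_beta_def eq fact_Suc F_def[symmetric]
    by (simp add: divide_simps) (simp add: algebra_simps)
qed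

text \<open>Excluding one part multiplies the generating function by a polynomial
  \<open>1 - q ^ p\<close>, so the induction closes without a remainder, unlike the distinct case.
  The start column runs through one residue class \<open>2 * m + e\<close>, which accounts for the
  factor \<open>1 / 2\<close>.\<close>

lemma has_mean_odd_window:
  assumes "finite W" "\<And>i. i \<in> W \<Longrightarrow> odd (e + i)"
  shows "has_mean (\<lambda>n. \<Sum>m\<le>n. real (shift (Suc a * (2 * m + e) + b)
           (mset_count ({m. odd m} - (+) (2 * m + e) ` W)) n)) (window_beta a (card W) / 2)"
  using assms
proof (induction W arbitrary: a b rule: finite_induct)
  case empty
  \<comment> \<open>By Euler's identity the unrestricted count is the same sequence as before, so
    \<open>strict_sum\<close> is the right normaliser here too.\<close>
  have "mset_count {m. odd m} = strict_count" by (auto simp: euler_odd_distinct)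
  moreover have "Suc a * (2 * m + e) + b = (2 * Suc a) * m + (Suc a * e + b)" for m
    by (simp add: algebra_simps)
  moreover have "window_beta a 0 / 2 = 1 / real (2 * Suc a)"
    by (simp add: window_beta_0 field_simps)
  ultimately show ?case using has_mean_progression[of "2 * Suc a" "Suc a * e + b"]
    by (simp only: image_empty Diff_empty card.empty) simp
next
  case (insert i W)
  define X where "X V a b n = (\<Sum>m\<le>n. real (shift (Suc a * (2 * m + e) + b)
    (mset_count ({m. odd m} - (+) (2 * m + e) ` V)) n))" for V a b n
  have "X (insert i W) a b n = X W a b n - X W (Suc a) (b + i) n" for n
  proof -
    have "shift (Suc a * (2 * m + e) + b) (mset_count ({m. odd m} - (+) (2 * m + e) ` W)) n =
      shift (Suc a * (2 * m + e) + b) (mset_count ({m. odd m} - (+) (2 * m + e) ` insert i W)) n +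
      shift (Suc (Suc a) * (2 * m + e) + (b + i)) (mset_count ({m. odd m} - (+) (2 * m + e) ` W)) n" for m
    proof -
      let ?A = "{m. odd m} - (+) (2 * m + e) ` W" and ?y = "2 * m + e + i"
      have A: "?A - {?y} = {m. odd m} - (+) (2 * m + e) ` insert i W" by auto
      have "0 \<notin> ?A" "?y \<in> ?A" using insert.prems insert.hyps by auto
      from mset_count_rec[OF this]
      have "mset_count ?A n = mset_count (?A - {?y}) n + shift ?y (mset_count ?A) n" for n .
      then have "shift (Suc a * (2 * m + e) + b) (mset_count ?A) n = shift (Suc a * (2 * m + e) + b)
        (\<lambda>n. mset_count (?A - {?y}) n + shift ?y (mset_count ?A) n) n"
        by (simp add: shift_def)
      then show ?thesis unfolding A shift_add shift_shift by (simp add: algebra_simps)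
    qed
    then show ?thesis by (simp add: X_def sum.distrib)
  qed
  then have "X (insert i W) a b = (\<lambda>n. X W a b n - X W (Suc a) (b + i) n)" by auto
  moreover have "has_mean (X W a b) (window_beta a (card W) / 2)" for a b
    using insert.IH insert.prems by (simp add: X_def[abs_def])
  ultimately have "has_mean (X (insert i W) a b) (window_beta a (card W) / 2 - window_beta (Suc a) (card W) / 2)"
    by (simp only: has_mean_diff)
  then show ?case using insert.hyps by (simp add: X_def[abs_def] window_beta_rec diff_divide_distrib)
qed

section \<open>Hooks and windows of parts\<close>

text \<open>The triple \<open>(x, j, t)\<close> stands for the box in column \<open>j\<close> of the row that has \<open>t\<close> further
  copies of its part \<open>x\<close> below it, so that multisets can replace sorted lists.\<close>

definition hook_triples :: "nat \<Rightarrow> nat multiset \<Rightarrow> (nat \<times> nat \<times> nat) set" where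
  "hook_triples h M =
     {(x, j, t). t < count M x \<and> j < x \<and> (x - j) + t + size {#y \<in># M. j < y \<and> y < x#} = h}"

lemma finite_hook_triples: "finite (hook_triples h M)"
proof (rule finite_subset)
  show "hook_triples h M \<subseteq> (SIGMA x:set_mset M. {..<x} \<times> {..<count M x})"
    by (auto simp: hook_triples_def simp flip: count_greater_zero_iff)
qed auto

lemma count_hook_numbers: "count (hook_numbers \<mu>) h = card {x \<in> ferrers \<mu>. hook_number \<mu> x = h}"
proof -
  have "{x. x \<in># mset_set (ferrers \<mu>) \<and> h = hook_number \<mu> x} = {x \<in> ferrers \<mu>. hook_number \<mu> x = h}"
    by (auto simp: finite_ferrers)
  then show ?thesis
    by (simp add: hook_numbers_def count_image_mset' finite_ferrers)
qed

lemma ferrers_Cons: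
  "ferrers (p # \<nu>) = Pair 0 ` {..<p} \<union> (\<lambda>(i, j). (Suc i, j)) ` ferrers \<nu>"
proof (intro equalityI subsetI)
  fix x assume "x \<in> ferrers (p # \<nu>)"
  then obtain i j where "x = (i, j)" "i < length (p # \<nu>)" "j < (p # \<nu>) ! i"
    by (auto simp: ferrers_def)
  then show "x \<in> Pair 0 ` {..<p} \<union> (\<lambda>(i, j). (Suc i, j)) ` ferrers \<nu>"
    by (cases i) (auto simp: ferrers_def)
qed (auto simp: ferrers_def)

lemma hook_number_Cons_Suc: "hook_number (p # \<nu>) (Suc i, j) = hook_number \<nu> (i, j)"
proof -
  have "hook (p # \<nu>) (Suc i, j) = (\<lambda>(k, l). (Suc k, l)) ` hook \<nu> (i, j)"
    by (auto simp: hook_def ferrers_Cons)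
  then show ?thesis unfolding hook_number_def by (auto intro!: card_image inj_onI)
qed

text \<open>\<open>p - j\<close> counts the box and its arm; the leg meets exactly the lower rows
  whose part exceeds \<open>j\<close>.\<close>

lemma hook_number_Cons_0:
  assumes "j < p"
  shows "hook_number (p # \<nu>) (0, j) = p - j + size {#y \<in># mset \<nu>. j < y#}"
proof -
  let ?L = "{k. k < length \<nu> \<and> j < \<nu> ! k}"
  have "hook (p # \<nu>) (0, j) = Pair 0 ` {j..<p} \<union> (\<lambda>k. (Suc k, j)) ` ?L"
    using assms by (auto simp: hook_def ferrers_Cons) (auto simp: ferrers_def)
  then have "hook_number (p # \<nu>) (0, j) = card (Pair (0::nat) ` {j..<p}) + card ((\<lambda>k. (Suc k, j)) ` ?L)"
    unfolding hook_number_def by (simp only:) (rule card_Un_disjoint; auto)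
  also have "card (Pair (0::nat) ` {j..<p}) = p - j" by (subst card_image) (auto intro: inj_onI)
  also have "card ((\<lambda>k. (Suc k, j)) ` ?L) = card ?L" by (rule card_image) (auto intro: inj_onI)
  also have "card ?L = size {#y \<in># mset \<nu>. j < y#}"
    by (simp add: length_filter_conv_card[symmetric] flip: mset_filter)
  finally show ?thesis .
qed

text \<open>A new top row with part \<open>p\<close> has all \<open>count N p\<close> older copies
  below it, hence this value of \<open>t\<close>. The older triples only look at parts below some
  \<open>x \<le> p\<close> and are unaffected.\<close>

lemma hook_triples_add_max:
  assumes "\<And>y. y \<in># N \<Longrightarrow> y \<le> p"
  shows "hook_triples h (add_mset p N) =
     (\<lambda>j. (p, j, count N p)) ` {j. j < p \<and> p - j + size {#y \<in># N. j < y#} = h} \<union> hook_triples h N"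
proof -
  have size: "size {#y \<in># N. j < y#} = count N p + size {#y \<in># N. j < y \<and> y < p#}" if "j < p" for j
  proof -
    have "{#y \<in># N. j < y#} = {#y \<in># N. y = p#} + {#y \<in># N. j < y \<and> y < p#}"
      using assms that by (auto simp: multiset_eq_iff count_eq_zero_iff) (metis le_neq_implies_less)
    then show ?thesis by (simp add: filter_eq_replicate_mset)
  qed
  have filter: "{#y \<in># add_mset p N. j < y \<and> y < x#} = {#y \<in># N. j < y \<and> y < x#}" if "x \<le> p" for x j
    using that by simp
  have le: "x \<le> p" if "t < count (add_mset p N) x" for x t
  proof -
    have "x \<in># add_mset p N" using that by (metis count_greater_zero_iff gr_zeroI not_less_zero)
    then show ?thesis using assms by auto
  qed
  have "(x, j, t) \<in> hook_triples h (add_mset p N) \<longleftrightarrow>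
      (x = p \<and> t = count N p \<and> j < p \<and> p - j + size {#y \<in># N. j < y#} = h) \<or> (x, j, t) \<in> hook_triples h N" for x j t
  proof (cases "t < count (add_mset p N) x")
    case True
    then show ?thesis
      using le[OF True] filter[OF le[OF True], of j] size[of j]
      by (cases "t < count N x") (auto simp: hook_triples_def split: if_splits)
  next
    case False
    then show ?thesis by (auto simp: hook_triples_def split: if_splits)
  qed
  then show ?thesis by auto
qed

text \<open>A row put on top changes no hook below it, and its own hooks match the new triples of
  \<open>hook_triples_add_max\<close>, which applies because the head of a decreasing list is its
  maximum.\<close>

lemma count_hook_numbers_eq_card:
  assumes "sorted_wrt (\<ge>) \<mu>"
  shows "count (hook_numbers \<mu>) h = card (hook_triples h (mset \<mu>))"
  using assms
proof (induction \<mu>)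
  case Nil
  have "hook_triples h {#} = {}" by (auto simp: hook_triples_def)
  then show ?case by (simp add: count_hook_numbers ferrers_def)
next
  case (Cons p \<nu>)
  let ?J = "{j. j < p \<and> p - j + size {#y \<in># mset \<nu>. j < y#} = h}"
  have split: "{x \<in> ferrers (p # \<nu>). hook_number (p # \<nu>) x = h} =
      Pair 0 ` ?J \<union> (\<lambda>(i, j). (Suc i, j)) ` {x \<in> ferrers \<nu>. hook_number \<nu> x = h}"
    by (auto simp: ferrers_Cons hook_number_Cons_Suc hook_number_Cons_0)
  have "count (hook_numbers (p # \<nu>)) h =
      card (Pair (0::nat) ` ?J) + card ((\<lambda>(i, j). (Suc i, j)) ` {x \<in> ferrers \<nu>. hook_number \<nu> x = h})"
    unfolding count_hook_numbers split by (rule card_Un_disjoint) (auto simp: finite_ferrers)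
  also have "\<dots> = card ((\<lambda>j. (p, j, count (mset \<nu>) p)) ` ?J) + card (hook_triples h (mset \<nu>))"
  proof (rule arg_cong2[where f = "(+)"])
    show "card (Pair (0::nat) ` ?J) = card ((\<lambda>j. (p, j, count (mset \<nu>) p)) ` ?J)"
      by (simp add: card_image inj_on_def)
    have "card ((\<lambda>(i, j). (Suc i, j)) ` {x \<in> ferrers \<nu>. hook_number \<nu> x = h}) =
        card {x \<in> ferrers \<nu>. hook_number \<nu> x = h}"
      by (rule card_image) (auto intro!: inj_onI)
    then show "card ((\<lambda>(i, j). (Suc i, j)) ` {x \<in> ferrers \<nu>. hook_number \<nu> x = h}) = card (hook_triples h (mset \<nu>))"
      using Cons by (simp add: count_hook_numbers)
  qed
  also have "\<dots> = card ((\<lambda>j. (p, j, count (mset \<nu>) p)) ` ?J \<union> hook_triples h (mset \<nu>))"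
    by (rule card_Un_disjoint[symmetric]) (simp_all add: finite_hook_triples, auto simp: hook_triples_def)
  also have "\<dots> = card (hook_triples h (mset (p # \<nu>)))"
    using Cons.prems by (subst mset.simps, subst hook_triples_add_max) auto
  finally show ?case .
qed

text \<open>A weakly decreasing list is recovered from its multiset by sorting and reversing.
  \<open>Q\<close> will say that the parts are odd or that they are distinct.\<close>

lemma bij_betw_partitions_msets:
  "bij_betw mset {\<mu> \<in> partitions_of n. Q (mset \<mu>)} {M. set_mset M \<subseteq> {0<..} \<and> \<Sum>\<^sub># M = n \<and> Q M}"
proof (rule bij_betw_byWitness[where f' = "\<lambda>M. rev (sorted_list_of_multiset M)"])
  show "\<forall>\<mu>\<in>{\<mu> \<in> partitions_of n. Q (mset \<mu>)}. rev (sorted_list_of_multiset (mset \<mu>)) = \<mu>"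
  proof
    fix \<mu> assume "\<mu> \<in> {\<mu> \<in> partitions_of n. Q (mset \<mu>)}"
    then have "sorted (rev \<mu>)" by (simp add: partitions_of_def sorted_wrt_rev)
    then have "sort \<mu> = rev \<mu>" by (intro properties_for_sort) auto
    then show "rev (sorted_list_of_multiset (mset \<mu>)) = \<mu>"
      by (simp add: sorted_list_of_multiset_mset)
  qed
  show "mset ` {\<mu> \<in> partitions_of n. Q (mset \<mu>)} \<subseteq> {M. set_mset M \<subseteq> {0<..} \<and> \<Sum>\<^sub># M = n \<and> Q M}"
    by (auto simp: partitions_of_def sum_mset_sum_list)
  show "(\<lambda>M. rev (sorted_list_of_multiset M)) ` {M. set_mset M \<subseteq> {0<..} \<and> \<Sum>\<^sub># M = n \<and> Q M}
      \<subseteq> {\<mu> \<in> partitions_of n. Q (mset \<mu>)}"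
  proof (intro image_subsetI)
    fix M assume M: "M \<in> {M. set_mset M \<subseteq> {0<..} \<and> \<Sum>\<^sub># M = n \<and> Q M}"
    have "sum_list (sorted_list_of_multiset M) = n"
      using M by (metis (mono_tags, lifting) mem_Collect_eq mset_sorted_list_of_multiset sum_mset_sum_list)
    then show "rev (sorted_list_of_multiset M) \<in> {\<mu> \<in> partitions_of n. Q (mset \<mu>)}"
      using M by (auto simp: partitions_of_def sorted_wrt_rev)
  qed
qed auto

text \<open>Here \<open>l\<close> is the arm length plus one, so the row has part
  \<open>j + l\<close>. With \<open>j\<close> and \<open>l\<close> fixed, the hook condition only
  concerns parts in \<open>{j + 1..j + l}\<close>.\<close>

definition hook_pairs :: "nat multiset set \<Rightarrow> nat \<Rightarrow> nat \<Rightarrow> nat \<Rightarrow> (nat multiset \<times> nat) set" where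
  "hook_pairs P h l j = {(M, t). M \<in> P \<and> t < count M (j + l) \<and>
     l + t + size {#y \<in># M. j < y \<and> y < j + l#} = h}"

text \<open>Hooks are regrouped by \<open>l = x - j\<close>. A box and its arm belong to the hook,
  so \<open>l \<le> h\<close>; parts are at most \<open>n\<close>, so
  \<open>j \<le> n\<close>.\<close>

lemma sum_count_hook_numbers:
  assumes P: "P = {M. set_mset M \<subseteq> {0<..} \<and> \<Sum>\<^sub># M = n \<and> Q M}"
  shows "(\<Sum>\<mu> | \<mu> \<in> partitions_of n \<and> Q (mset \<mu>). count (hook_numbers \<mu>) h) =
    (\<Sum>l\<in>{1..h}. \<Sum>j\<le>n. card (hook_pairs P h l j))"
proof -
  have finP: "finite P"
    by (rule finite_subset[OF _ finite_msets_sum[of "{0<..}" n]]) (auto simp: P)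
  have "(\<Sum>\<mu> | \<mu> \<in> partitions_of n \<and> Q (mset \<mu>). count (hook_numbers \<mu>) h) =
      (\<Sum>\<mu> | \<mu> \<in> partitions_of n \<and> Q (mset \<mu>). card (hook_triples h (mset \<mu>)))"
    by (intro sum.cong) (auto simp: partitions_of_def count_hook_numbers_eq_card)
  also have "\<dots> = (\<Sum>M\<in>P. card (hook_triples h M))"
    unfolding P by (rule sum.reindex_bij_betw[OF bij_betw_partitions_msets])
  also have "\<dots> = card (SIGMA M:P. hook_triples h M)"
    by (rule card_SigmaI[symmetric]) (auto simp: finP finite_hook_triples)
  also have "\<dots> = card (SIGMA z:{1..h} \<times> {..n}. hook_pairs P h (fst z) (snd z))"
  proof (rule bij_betw_same_card)
    show "bij_betw (\<lambda>(M, x, j, t). ((x - j, j), M, t)) (SIGMA M:P. hook_triples h M)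
      (SIGMA z:{1..h} \<times> {..n}. hook_pairs P h (fst z) (snd z))"
    proof (rule bij_betw_byWitness[where f' = "\<lambda>((l, j), M, t). (M, j + l, j, t)"])
      have "x \<le> n" if "M \<in> P" "t < count M x" for M x t
      proof -
        have "x \<in># M" using that by (metis count_greater_zero_iff gr_zeroI not_less_zero)
        then show ?thesis using that by (auto simp: P sum_mset.remove)
      qed
      then show "(\<lambda>(M, x, j, t). ((x - j, j), M, t)) ` (SIGMA M:P. hook_triples h M)
          \<subseteq> (SIGMA z:{1..h} \<times> {..n}. hook_pairs P h (fst z) (snd z))"
        by (fastforce simp: hook_triples_def hook_pairs_def)
    qed (auto simp: hook_triples_def hook_pairs_def)
  qed
  also have "\<dots> = (\<Sum>z\<in>{1..h} \<times> {..n}. card (hook_pairs P h (fst z) (snd z)))"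
  proof (rule card_SigmaI)
    have "hook_pairs P h l j \<subseteq> P \<times> {..h}" for l j by (auto simp: hook_pairs_def)
    then show "\<forall>z\<in>{1..h} \<times> {..n}. finite (hook_pairs P h (fst z) (snd z))"
      using finP by (meson finite_SigmaI finite_atMost finite_subset)
  qed auto
  also have "\<dots> = (\<Sum>l\<in>{1..h}. \<Sum>j\<le>n. card (hook_pairs P h l j))"
    by (simp add: sum.cartesian_product case_prod_unfold)
  finally show ?thesis .
qed

section \<open>Window patterns for distinct parts\<close>

text \<open>For a hook with arm length \<open>l - 1\<close> that starts in column \<open>j\<close>, these are the possible sets of
  parts in \<open>{j + 1..j + l}\<close>, translated by \<open>- j\<close>.\<close>

definition strict_patterns :: "nat \<Rightarrow> nat \<Rightarrow> nat set set" where
  "strict_patterns h l = {T. T \<subseteq> {1..l} \<and> l \<in> T \<and> card T + l = Suc h}"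

lemma finite_strict_patterns: "finite (strict_patterns h l)"
  by (rule finite_subset[of _ "Pow {1..l}"]) (auto simp: strict_patterns_def)

text \<open>Besides \<open>l\<close> itself, a pattern is an arbitrary set of \<open>h - l\<close>
  elements of \<open>{1..<l}\<close>.\<close>

lemma card_strict_patterns:
  assumes "l \<in> {1..h}"
  shows "card (strict_patterns h l) = (l - 1) choose (h - l)"
proof -
  have "bij_betw (insert l) {T. T \<subseteq> {1..<l} \<and> card T = h - l} (strict_patterns h l)"
  proof (rule bij_betw_byWitness[where f' = "\<lambda>T. T - {l}"])
    show "insert l ` {T. T \<subseteq> {1..<l} \<and> card T = h - l} \<subseteq> strict_patterns h l"
    proof (intro image_subsetI)
      fix T assume "T \<in> {T. T \<subseteq> {1..<l} \<and> card T = h - l}"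
      moreover from this have "finite T" "l \<notin> T" by (auto intro: finite_subset)
      ultimately show "insert l T \<in> strict_patterns h l" using assms by (auto simp: strict_patterns_def)
    qed
    show "(\<lambda>T. T - {l}) ` strict_patterns h l \<subseteq> {T. T \<subseteq> {1..<l} \<and> card T = h - l}"
    proof (intro image_subsetI)
      fix T assume T: "T \<in> strict_patterns h l"
      then have "finite T" by (auto simp: strict_patterns_def intro: finite_subset)
      then show "T - {l} \<in> {T. T \<subseteq> {1..<l} \<and> card T = h - l}"
        using T assms by (fastforce simp: strict_patterns_def)
    qed
  qed (auto simp: strict_patterns_def)
  from bij_betw_same_card[OF this] show ?thesis
    using n_subsets[of "{1..<l}" "h - l"] by simp
qed

definition strict_msets :: "nat \<Rightarrow> nat multiset set" where
  "strict_msets n = {M. set_mset M \<subseteq> {0<..} \<and> \<Sum>\<^sub># M = n \<and> (\<forall>x. count M x \<le> 1)}"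

lemma mset_set_set_mset:
  assumes "\<And>x. count M x \<le> 1"
  shows "mset_set (set_mset M) = M"
proof (rule multiset_eqI)
  fix x
  show "count (mset_set (set_mset M)) x = count M x"
  proof (cases "x \<in># M")
    case True
    then have "count M x = 1" using assms[of x] by (metis count_greater_eq_one_iff le_antisym)
    with True show ?thesis by (simp add: count_mset_set')
  next
    case False
    then have "count M x = 0" by (simp only: not_in_iff)
    with False show ?thesis by (simp add: count_mset_set')
  qed
qed

lemma hook_b_eq: "hook_b h n = (\<Sum>l\<in>{1..h}. \<Sum>j\<le>n. card (hook_pairs (strict_msets n) h l j))"
proof -
  have "distinct \<mu> \<longleftrightarrow> (\<forall>x. count (mset \<mu>) x \<le> 1)" for \<mu> :: "nat list"
    unfolding distinct_count_atmost_1
    by (metis count_mset_0_iff le_Suc_eq le_zero_eq One_nat_def order_refl zero_le_one)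
  then have "distinct_partitions n = {\<mu> \<in> partitions_of n. \<forall>x. count (mset \<mu>) x \<le> 1}"
    by (auto simp: distinct_partitions_def)
  then show ?thesis unfolding hook_b_def
    using sum_count_hook_numbers[OF strict_msets_def] by simp
qed

text \<open>Distinctness forces \<open>t = 0\<close>, so the hook length depends only on the pattern
  \<open>T\<close>, and the parts outside the window are free. A pattern has
  \<open>h - l + 1\<close> elements, so its translate by \<open>j\<close> has sum
  \<open>(h - l + 1) * j + \<Sum>T\<close>.\<close>

lemma card_hook_pairs_strict:
  assumes l: "l \<in> {1..h}"
  shows "card (hook_pairs (strict_msets n) h l j) =
    (\<Sum>T\<in>strict_patterns h l. shift (Suc (h - l) * j + \<Sum>T) (subset_count ({0<..} - (+) j ` {1..l})) n)"
proof -
  let ?D = "\<lambda>T. {S. finite S \<and> S \<subseteq> {0<..} \<and> \<Sum>S = n \<and> S \<inter> (+) j ` {1..l} = (+) j ` T}"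
  have win: "(+) j ` {1..l} = {j<..j + l}"
    using image_add_atLeastAtMost[of j 1 l] by (auto simp: atLeastSucAtMost_greaterThanAtMost add.commute)
  \<comment> \<open>The added \<open>1\<close> accounts for the part \<open>j + l\<close>, which
    lies in the window but is not met by the leg.\<close>
  have size: "size {#y \<in># mset_set S. j < y \<and> y < j + l#} + 1 = card T"
    if "finite S" "S \<inter> (+) j ` {1..l} = (+) j ` T" "l \<in> T" for S T
  proof -
    have "{y \<in> S. j < y \<and> y < j + l} = (S \<inter> (+) j ` {1..l}) - {j + l}" using l by (auto simp: win)
    also have "\<dots> = (+) j ` (T - {l})" unfolding that by auto
    finally have "card {y \<in> S. j < y \<and> y < j + l} = card (T - {l})" by (simp add: card_image)
    moreover have "finite T" using that(1,2) by (metis finite_Int finite_imageD inj_on_add)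
    ultimately show ?thesis using that by (simp add: filter_mset_mset_set card_gt_0_iff) 
        (metis One_nat_def Suc_pred card_gt_0_iff empty_iff)
  qed
  have "bij_betw (\<lambda>(T, S). (mset_set S, 0::nat)) (SIGMA T:strict_patterns h l. ?D T)
     (hook_pairs (strict_msets n) h l j)"
  proof (rule bij_betw_byWitness[where
        f' = "\<lambda>(M, t). ((\<lambda>y. y - j) ` (set_mset M \<inter> {j<..j + l}), set_mset M)"])
    show "\<forall>a\<in>SIGMA T:strict_patterns h l. ?D T.
        (case case a of (T, S) \<Rightarrow> (mset_set S, 0::nat) of
          (M, t) \<Rightarrow> ((\<lambda>y. y - j) ` (set_mset M \<inter> {j<..j + l}), set_mset M)) = a"
    proof (rule ballI, goal_cases)
      case (1 a)
      then obtain T S where a: "a = (T, S)" and S: "finite S" "S \<inter> (+) j ` {1..l} = (+) j ` T" by auto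
      have "(\<lambda>y. y - j) ` (S \<inter> {j<..j + l}) = (\<lambda>y. y - j) ` (+) j ` T"
        by (simp only: S(2) win[symmetric])
      also have "\<dots> = T" by (simp add: image_image)
      finally show ?case unfolding a prod.case using S(1) by simp
    qed
    show "\<forall>a'\<in>hook_pairs (strict_msets n) h l j.
        (case case a' of (M, t) \<Rightarrow> ((\<lambda>y. y - j) ` (set_mset M \<inter> {j<..j + l}), set_mset M) of
          (T, S) \<Rightarrow> (mset_set S, 0)) = a'"
    proof (rule ballI, goal_cases)
      case (1 a)
      obtain M t where a: "a = (M, t)" by (cases a)
      with 1 have M: "\<And>x. count M x \<le> 1" and t: "t < count M (j + l)"
        by (auto simp: hook_pairs_def strict_msets_def)
      have "t = 0" using less_le_trans[OF t M] by simp
      moreover have "mset_set (set_mset M) = M" using M by (rule mset_set_set_mset)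
      ultimately show ?case unfolding a prod.case by simp
    qed
    show "(\<lambda>(T, S). (mset_set S, 0)) ` (SIGMA T:strict_patterns h l. ?D T) \<subseteq> hook_pairs (strict_msets n) h l j"
    proof (clarify)
      fix T S assume T: "T \<in> strict_patterns h l" and S: "finite S" "S \<subseteq> {0<..}" "n = \<Sum>S"
        "S \<inter> (+) j ` {1..l} = (+) j ` T"
      have lT: "l \<in> T" "card T + l = Suc h" using T by (auto simp: strict_patterns_def)
      have "j + l \<in> S" using S(4) lT by blast
      moreover have "l + size {#y \<in># mset_set S. j < y \<and> y < j + l#} = h"
        using size[OF S(1,4) lT(1)] lT by linarith
      moreover have "\<Sum>\<^sub># (mset_set S) = \<Sum>S" using sum_unfold_sum_mset[of "\<lambda>x. x" S] by simp
      ultimately show "(mset_set S, 0) \<in> hook_pairs (strict_msets (\<Sum>S)) h l j"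
        using S by (auto simp: hook_pairs_def strict_msets_def count_mset_set')
    qed
    show "(\<lambda>(M, t). ((\<lambda>y. y - j) ` (set_mset M \<inter> {j<..j + l}), set_mset M)) ` hook_pairs (strict_msets n) h l j
        \<subseteq> (SIGMA T:strict_patterns h l. ?D T)"
    proof (rule image_subsetI, goal_cases)
      case (1 a)
      obtain M t where a: "a = (M, t)" by (cases a)
      with 1 have Mt: "(M, t) \<in> hook_pairs (strict_msets n) h l j" by simp
      let ?T = "(\<lambda>y. y - j) ` (set_mset M \<inter> {j<..j + l})"
      from Mt have M: "set_mset M \<subseteq> {0<..}" "\<Sum>\<^sub># M = n" "\<And>x. count M x \<le> 1" "t < count M (j + l)"
        "l + t + size {#y \<in># M. j < y \<and> y < j + l#} = h"
        by (auto simp: hook_pairs_def strict_msets_def)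
      have t: "t = 0" using M(3)[of "j + l"] M(4) by simp
      have eq: "mset_set (set_mset M) = M" using M(3) by (rule mset_set_set_mset)
      have "j + l \<in># M" using M(4) by (metis count_greater_zero_iff gr_zeroI not_less_zero)
      then have lT: "l \<in> ?T" using l by (force intro: image_eqI[of _ _ "j + l"])
      have TD: "set_mset M \<inter> (+) j ` {1..l} = (+) j ` ?T" by (force simp: win image_image)
      from size[OF finite_set_mset this lT] M(5) t have "card ?T + l = Suc h" by (simp add: eq)
      moreover have "?T \<subseteq> {1..l}" by auto
      moreover have "\<Sum>(set_mset M) = n" using sum_unfold_sum_mset[of "\<lambda>x. x" "set_mset M"] M(2) by (simp add: eq)
      ultimately show ?case
        unfolding a prod.case using lT TD M(1) by (auto simp: strict_patterns_def)
    qed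
  qed
  from bij_betw_same_card[OF this]
  have "card (hook_pairs (strict_msets n) h l j) = card (SIGMA T:strict_patterns h l. ?D T)" by (rule sym)
  also have "\<dots> = (\<Sum>T\<in>strict_patterns h l. card (?D T))"
  proof (rule card_SigmaI)
    show "\<forall>T\<in>strict_patterns h l. finite (?D T)"
      by (auto intro: finite_subset[OF _ finite_subsets_sum[of "{0<..}" n]])
  qed (rule finite_strict_patterns)
  also have "\<dots> = (\<Sum>T\<in>strict_patterns h l. shift (Suc (h - l) * j + \<Sum>T) (subset_count ({0<..} - (+) j ` {1..l})) n)"
  proof (rule sum.cong)
    fix T assume T: "T \<in> strict_patterns h l"
    then have T': "T \<subseteq> {1..l}" "card T = Suc (h - l)" "finite T"
      using l by (auto simp: strict_patterns_def intro: finite_subset)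
    have "\<Sum>((+) j ` T) = (\<Sum>i\<in>T. j + i)" by (simp add: sum.reindex)
    also have "\<dots> = Suc (h - l) * j + \<Sum>T" by (simp add: sum.distrib T'(2))
    finally have sum: "\<Sum>((+) j ` T) = Suc (h - l) * j + \<Sum>T" .
    have "card (?D T) = shift (\<Sum>((+) j ` T)) (subset_count ({0<..} - (+) j ` {1..l})) n"
      using T' by (intro subset_count_restrict image_mono) auto
    then show "card (?D T) = shift (Suc (h - l) * j + \<Sum>T) (subset_count ({0<..} - (+) j ` {1..l})) n"
      by (simp only: sum)
  qed simp
  finally show ?thesis .
qed

definition hook_b_limit :: "nat \<Rightarrow> real" where
  "hook_b_limit h = (\<Sum>l\<in>{1..h}. real ((l - 1) choose (h - l)) * window_integral (h - l) l)"

text \<open>Patterns with the same \<open>l\<close> differ only in the offset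
  \<open>\<Sum>T\<close>, which does not influence the mean. Each contributes the same integral, and
  the binomial coefficient counts them.\<close>

lemma has_mean_hook_b: "has_mean (\<lambda>n. real (hook_b h n)) (hook_b_limit h)"
proof -
  have "real (hook_b h n) = (\<Sum>l\<in>{1..h}. \<Sum>T\<in>strict_patterns h l. \<Sum>j\<le>n.
      real (shift (Suc (h - l) * j + \<Sum>T) (subset_count ({0<..} - (+) j ` {1..l})) n))" for n
  proof -
    have "real (hook_b h n) = (\<Sum>l\<in>{1..h}. \<Sum>j\<le>n. \<Sum>T\<in>strict_patterns h l.
      real (shift (Suc (h - l) * j + \<Sum>T) (subset_count ({0<..} - (+) j ` {1..l})) n))"
      unfolding hook_b_eq of_nat_sum by (intro sum.cong refl) (simp add: card_hook_pairs_strict)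
    then show ?thesis by (simp add: sum.swap[of _ "strict_patterns h _"])
  qed
  moreover have "has_mean (\<lambda>n. \<Sum>l\<in>{1..h}. \<Sum>T\<in>strict_patterns h l. \<Sum>j\<le>n.
      real (shift (Suc (h - l) * j + \<Sum>T) (subset_count ({0<..} - (+) j ` {1..l})) n))
      (\<Sum>l\<in>{1..h}. \<Sum>T\<in>strict_patterns h l. window_integral (h - l) (card {1..l}))"
    by (intro has_mean_sum has_mean_strict_window) auto
  moreover have "(\<Sum>l\<in>{1..h}. \<Sum>T\<in>strict_patterns h l. window_integral (h - l) (card {1..l})) = hook_b_limit h"
    unfolding hook_b_limit_def by (intro sum.cong refl) (simp add: card_strict_patterns)
  ultimately show ?thesis by simp
qed

section \<open>Window patterns for odd parts\<close>

text \<open>The offsets \<open>i < l\<close> for which \<open>j + i\<close> can be a part below the odd part \<open>j + l\<close>.\<close>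

definition odd_window :: "nat \<Rightarrow> nat set" where
  "odd_window l = {i \<in> {1..<l}. even (l + i)}"

lemma card_odd_window: "card (odd_window l) = (l - 1) div 2"
proof -
  have "bij_betw (\<lambda>r. l - 2 * r) {1..(l - 1) div 2} (odd_window l)"
  proof (rule bij_betw_byWitness[where f' = "\<lambda>i. (l - i) div 2"])
    show "\<forall>i\<in>odd_window l. l - 2 * ((l - i) div 2) = i" by (simp add: odd_window_def)
    show "(\<lambda>r. l - 2 * r) ` {1..(l - 1) div 2} \<subseteq> odd_window l" by (auto simp: odd_window_def)
    show "(\<lambda>i. (l - i) div 2) ` odd_window l \<subseteq> {1..(l - 1) div 2}"
      by (rule image_subsetI) (simp add: odd_window_def, presburger)
  qed auto
  from bij_betw_same_card[OF this] show ?thesis by simp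
qed

definition odd_msets :: "nat \<Rightarrow> nat multiset set" where
  "odd_msets n = {M. set_mset M \<subseteq> {0<..} \<and> \<Sum>\<^sub># M = n \<and> (\<forall>p\<in>#M. odd p)}"

lemma hook_a_eq: "hook_a h n = (\<Sum>l\<in>{1..h}. \<Sum>j\<le>n. card (hook_pairs (odd_msets n) h l j))"
proof -
  have "odd_partitions n = {\<mu> \<in> partitions_of n. \<forall>p\<in>#mset \<mu>. odd p}"
    by (auto simp: odd_partitions_def)
  then show ?thesis unfolding hook_a_def
    using sum_count_hook_numbers[OF odd_msets_def] by simp
qed

lemma hook_pairs_odd_empty:
  assumes "even (j + l)"
  shows "hook_pairs (odd_msets n) h l j = {}"
proof -
  have "count M (j + l) = 0" if "M \<in> odd_msets n" for M
    using that assms by (auto simp: odd_msets_def count_eq_zero_iff)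
  then show ?thesis by (auto simp: hook_pairs_def)
qed

text \<open>\<open>K\<close> records the parts met by the leg, translated by \<open>- j\<close>:
  \<open>count K l\<close> copies of \<open>j + l\<close> and everything strictly inside the window.
  One further copy of \<open>l\<close> stands for the row of the box. The rest \<open>R\<close> may
  still contain \<open>j + l\<close>, for equal rows above the box, so only
  \<open>odd_window l\<close> is excluded.\<close>

lemma card_hook_pairs_odd:
  assumes l: "l \<in> {1..h}" and odd: "odd (j + l)"
  shows "card (hook_pairs (odd_msets n) h l j) =
    (\<Sum>K\<in>multisets_of_size (insert l (odd_window l)) (h - l).
      shift (Suc (h - l) * j + (\<Sum>\<^sub># K + l)) (mset_count ({m. odd m} - (+) j ` odd_window l)) n)"
proof -
  let ?K = "multisets_of_size (insert l (odd_window l)) (h - l)"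
  let ?A = "{m. odd m} - (+) j ` odd_window l"
  let ?R = "\<lambda>K. {R \<in> {R. set_mset R \<subseteq> ?A}. \<Sum>\<^sub># R + (Suc (h - l) * j + (\<Sum>\<^sub># K + l)) = n}"
  let ?in = "\<lambda>M. {#y \<in># M. j < y \<and> y < j + l#}"
  \<comment> \<open>Only the \<open>t\<close> copies of \<open>j + l\<close> below the box enter the
    pattern, not all copies in \<open>M\<close>.\<close>
  let ?pat = "\<lambda>M t. image_mset (\<lambda>y. y - j) (?in M) + replicate_mset t l"
  have win: "y \<in> (+) j ` odd_window l" if "odd y" "j < y" "y < j + l" for y
  proof -
    have "even (l + (y - j))" using that odd by presburger
    then have "y - j \<in> odd_window l" using that by (auto simp: odd_window_def)
    then show ?thesis using that by (intro image_eqI[of _ _ "y - j"]) auto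
  qed
  have inA: "?in R = {#}" if "set_mset R \<subseteq> ?A" for R
    using that win by (auto simp: filter_mset_eq_conv)
  have inK: "?in (image_mset ((+) j) K) = image_mset ((+) j) {#i \<in># K. i \<noteq> l#}"
    if "set_mset K \<subseteq> insert l (odd_window l)" for K
    unfolding filter_mset_image_mset using that
    by (intro arg_cong[of _ _ "image_mset _"] filter_mset_cong) (auto simp: odd_window_def)
  have sum_shift: "\<Sum>\<^sub># (image_mset ((+) j) (add_mset l K)) = Suc (size K) * j + (\<Sum>\<^sub># K + l)" for K
    by (induction K) auto
  have "bij_betw (\<lambda>(K, R). (R + image_mset ((+) j) (add_mset l K), count K l)) (SIGMA K:?K. ?R K)
     (hook_pairs (odd_msets n) h l j)"
  proof (rule bij_betw_byWitness[where f' = "\<lambda>(M, t). (?pat M t, M - image_mset ((+) j) (add_mset l (?pat M t)))"])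
    show "\<forall>a\<in>SIGMA K:?K. ?R K.
       (case case a of (K, R) \<Rightarrow> (R + image_mset ((+) j) (add_mset l K), count K l) of
          (M, t) \<Rightarrow> (?pat M t, M - image_mset ((+) j) (add_mset l (?pat M t)))) = a"
    proof (rule ballI, goal_cases)
      case (1 a)
      then obtain K R where a: "a = (K, R)" and K: "K \<in> ?K" and R: "set_mset R \<subseteq> ?A" by auto
      let ?M = "R + image_mset ((+) j) (add_mset l K)"
      have "?in ?M = image_mset ((+) j) {#i \<in># K. i \<noteq> l#}"
        using inA[OF R] inK[of K] K by (simp add: multisets_of_size_def)
      then have "?pat ?M (count K l) = {#i \<in># K. i \<noteq> l#} + {#i \<in># K. i = l#}"
        by (simp add: image_mset.compositionality o_def filter_eq_replicate_mset)
      also have "\<dots> = K" by (metis add.commute multiset_partition)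
      finally show ?case unfolding a prod.case by simp
    qed
    \<comment> \<open>\<open>Suc t\<close> copies: the \<open>t\<close> copies in the leg and the
      row of the box itself.\<close>
    have image_pat: "image_mset ((+) j) (add_mset l (?pat M t)) = ?in M + replicate_mset (Suc t) (j + l)" for M t
    proof -
      have "image_mset ((+) j) (image_mset (\<lambda>y. y - j) (?in M)) = image_mset id (?in M)"
        unfolding image_mset.compositionality by (rule image_mset_cong) auto
      then show ?thesis by simp
    qed
    have sub: "?in M + replicate_mset (Suc t) (j + l) \<subseteq># M" if "t < count M (j + l)" for M t
      using that by (auto simp: subseteq_mset_def)
    have cnt: "count (?pat M t) l = t" for M t
    proof -
      have "l \<notin># image_mset (\<lambda>y. y - j) (?in M)" by auto
      then have "count (image_mset (\<lambda>y. y - j) (?in M)) l = 0" by (simp only: not_in_iff)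
      then show ?thesis by simp
    qed
    show "\<forall>a'\<in>hook_pairs (odd_msets n) h l j.
       (case case a' of (M, t) \<Rightarrow> (?pat M t, M - image_mset ((+) j) (add_mset l (?pat M t))) of
          (K, R) \<Rightarrow> (R + image_mset ((+) j) (add_mset l K), count K l)) = a'"
    proof (rule ballI, goal_cases)
      case (1 a)
      obtain M t where a: "a = (M, t)" by (cases a)
      with 1 have "t < count M (j + l)" by (simp add: hook_pairs_def)
      from subset_mset.diff_add[OF sub[OF this]]
      show ?case unfolding a prod.case image_pat cnt by simp
    qed
    show "(\<lambda>(K, R). (R + image_mset ((+) j) (add_mset l K), count K l)) ` (SIGMA K:?K. ?R K)
        \<subseteq> hook_pairs (odd_msets n) h l j"
    proof (rule image_subsetI, goal_cases)
      case (1 a)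
      obtain K R where a: "a = (K, R)" by (cases a)
      with 1 have K: "K \<in> ?K" and R: "set_mset R \<subseteq> ?A"
        and n: "\<Sum>\<^sub># R + (Suc (h - l) * j + (\<Sum>\<^sub># K + l)) = n" by auto
      let ?M = "R + image_mset ((+) j) (add_mset l K)"
      have K': "set_mset K \<subseteq> insert l (odd_window l)" "size K = h - l"
        using K by (auto simp: multisets_of_size_def)
      have "size (?in ?M) = size {#i \<in># K. i \<noteq> l#}"
        using inA[OF R] inK[OF K'(1)] by simp
      moreover have "size K = size {#i \<in># K. i = l#} + size {#i \<in># K. i \<noteq> l#}"
        by (metis multiset_partition size_union)
      moreover have "size {#i \<in># K. i = l#} = count K l" by (simp add: filter_eq_replicate_mset)
      moreover have "l \<le> h" using l by simp
      ultimately have "l + count K l + size (?in ?M) = h" using K'(2) by linarith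
      moreover have "count K l < count ?M (j + l)"
      proof -
        have "count (image_mset ((+) j) K) (j + l) = count K l" by (induction K) auto
        then show ?thesis by simp
      qed
      moreover have odd_M: "odd p" if "p \<in># ?M" for p
        using that R K'(1) odd by (auto simp: odd_window_def)
      moreover have "set_mset ?M \<subseteq> {0<..}"
      proof
        fix p assume "p \<in># ?M"
        from odd_pos[OF odd_M[OF this]] show "p \<in> {0<..}" by simp
      qed
      moreover have "\<Sum>\<^sub># ?M = n" using sum_shift[of K] n K'(2) by simp
      ultimately show ?case unfolding a
        by (simp only: hook_pairs_def odd_msets_def mem_Collect_eq prod.case) blast
    qed
    show "(\<lambda>(M, t). (?pat M t, M - image_mset ((+) j) (add_mset l (?pat M t)))) ` hook_pairs (odd_msets n) h l j
        \<subseteq> (SIGMA K:?K. ?R K)"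
    proof (rule image_subsetI, goal_cases)
      case (1 a)
      obtain M t where a: "a = (M, t)" by (cases a)
      with 1 have M: "\<Sum>\<^sub># M = n" "\<And>p. p \<in># M \<Longrightarrow> odd p" "t < count M (j + l)" "l + t + size (?in M) = h"
        by (auto simp: hook_pairs_def odd_msets_def)
      let ?R' = "M - image_mset ((+) j) (add_mset l (?pat M t))"
      have "set_mset (?pat M t) \<subseteq> insert l (odd_window l)"
      proof
        fix i assume "i \<in># ?pat M t"
        then consider "i = l" | y where "y \<in># M" "j < y" "y < j + l" "i = y - j"
          by (auto split: if_splits)
        then show "i \<in> insert l (odd_window l)"
        proof cases
          case 2
          then show ?thesis using win[OF M(2)[OF 2(1)] 2(2,3)] by auto
        qed simp
      qed
      moreover have size: "size (?pat M t) = h - l" using M(4) by simp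
      ultimately have K: "?pat M t \<in> ?K" by (simp add: multisets_of_size_def)
      have sub_A: "set_mset ?R' \<subseteq> ?A"
      proof
        fix y assume y: "y \<in># ?R'"
        then have "odd y" using M(2) by (meson in_diffD)
        moreover have "y \<notin> (+) j ` odd_window l"
        proof
          assume "y \<in> (+) j ` odd_window l"
          then have "j < y" "y < j + l" by (auto simp: odd_window_def)
          then have "count ?R' y = 0" unfolding image_pat by simp
          then have "y \<notin># ?R'" by (rule iffD1[OF count_eq_zero_iff])
          with y show False by contradiction
        qed
        ultimately show "y \<in> ?A" by simp
      qed
      have sum_R: "\<Sum>\<^sub># ?R' + (Suc (h - l) * j + (\<Sum>\<^sub># (?pat M t) + l)) = n"
      proof -
        have eq: "?R' + image_mset ((+) j) (add_mset l (?pat M t)) = M"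
          unfolding image_pat by (rule subset_mset.diff_add[OF sub[OF M(3)]])
        have "\<Sum>\<^sub># ?R' + \<Sum>\<^sub># (image_mset ((+) j) (add_mset l (?pat M t))) = n"
          unfolding sum_mset.union[symmetric] eq by (rule M(1))
        then show ?thesis by (simp only: sum_shift size)
      qed
      show ?case unfolding a prod.case by (intro SigmaI CollectI conjI K sub_A sum_R)
    qed
  qed
  from bij_betw_same_card[OF this]
  have "card (hook_pairs (odd_msets n) h l j) = card (SIGMA K:?K. ?R K)" by (rule sym)
  also have "\<dots> = (\<Sum>K\<in>?K. card (?R K))"
  proof (rule card_SigmaI)
    have "finite (?R K)" for K
      by (rule finite_subset[OF _ finite_msets_sum[of ?A "n - (Suc (h - l) * j + (\<Sum>\<^sub># K + l))"]]) auto
    then show "\<forall>K\<in>?K. finite (?R K)" by simp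
  qed (auto simp: odd_window_def)
  also have "\<dots> = (\<Sum>K\<in>?K. shift (Suc (h - l) * j + (\<Sum>\<^sub># K + l)) (mset_count ?A) n)"
  proof (intro sum.cong refl)
    fix K
    from card_shift[OF bij_betw_id[of "?R K", unfolded id_def]]
    show "card (?R K) = shift (Suc (h - l) * j + (\<Sum>\<^sub># K + l)) (mset_count ?A) n"
      by (simp add: mset_count_def[abs_def])
  qed
  finally show ?thesis .
qed

definition hook_a_limit :: "nat \<Rightarrow> real" where
  "hook_a_limit h = (\<Sum>l\<in>{1..h}. 1 / real (h - l div 2)) / 2"

text \<open>\<open>Suc l mod 2\<close> is the parity of \<open>j\<close> that makes
  \<open>j + l\<close> odd. The range on the right is longer than necessary, but the extra indices
  exceed \<open>n\<close>, where \<open>f\<close> vanishes.\<close>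

lemma sum_parity:
  assumes "\<And>j. j > n \<Longrightarrow> f j = (0::real)"
  shows "(\<Sum>j\<le>n. if odd (j + l) then f j else 0) = (\<Sum>m\<le>n. f (2 * m + Suc l mod 2))"
proof -
  have bij: "2 * (j div 2) + Suc l mod 2 = j" if "odd (j + l)" for j using that by presburger
  have inv: "(2 * m + Suc l mod 2) div 2 = m" "odd (2 * m + Suc l mod 2 + l)" for m by presburger+
  have "(\<Sum>j\<le>n. if odd (j + l) then f j else 0) = (\<Sum>j | j \<le> n \<and> odd (j + l). f j)"
    by (subst sum.inter_filter[symmetric]) (auto simp: atMost_def)
  also have "\<dots> = (\<Sum>m | 2 * m + Suc l mod 2 \<le> n. f (2 * m + Suc l mod 2))"
    by (rule sum.reindex_bij_witness[where i = "\<lambda>m. 2 * m + Suc l mod 2" and j = "\<lambda>j. j div 2"])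
       (simp_all only: mem_Collect_eq bij inv simp_thms)
  also have "\<dots> = (\<Sum>m\<le>n. f (2 * m + Suc l mod 2))"
    by (rule sum.mono_neutral_left) (auto intro!: assms)
  finally show ?thesis .
qed

text \<open>The Bernstein polynomials of degree \<open>a + k\<close> all have the same integral over
  \<open>[0, 1]\<close>.\<close>

lemma binomial_window_beta: "real ((a + k) choose a) * window_beta a k = 1 / real (a + k + 1)"
proof -
  have "real ((a + k) choose a) * window_beta a k =
      fact (a + k) / (fact a * fact k) * (fact a * fact k / (real (a + k + 1) * fact (a + k)))"
    by (simp add: binomial_fact window_beta_def)
  also have "\<dots> = 1 / real (a + k + 1)" by simp
  finally show ?thesis .
qed

lemma has_mean_hook_a: "has_mean (\<lambda>n. real (hook_a h n)) (hook_a_limit h)"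
proof -
  let ?K = "\<lambda>l. multisets_of_size (insert l (odd_window l)) (h - l)"
  let ?s = "\<lambda>l K n j. real (shift (Suc (h - l) * j + (\<Sum>\<^sub># K + l)) (mset_count ({m. odd m} - (+) j ` odd_window l)) n)"
  have "real (hook_a h n) = (\<Sum>l\<in>{1..h}. \<Sum>K\<in>?K l. \<Sum>m\<le>n. ?s l K n (2 * m + Suc l mod 2))" for n
  proof -
    have "real (hook_a h n) = (\<Sum>l\<in>{1..h}. \<Sum>j\<le>n. if odd (j + l) then \<Sum>K\<in>?K l. ?s l K n j else 0)"
      unfolding hook_a_eq of_nat_sum
      by (intro sum.cong refl) (simp add: card_hook_pairs_odd hook_pairs_odd_empty)
    also have "\<dots> = (\<Sum>l\<in>{1..h}. \<Sum>m\<le>n. \<Sum>K\<in>?K l. ?s l K n (2 * m + Suc l mod 2))"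
      by (intro sum.cong refl sum_parity) (auto simp: shift_def)
    also have "\<dots> = (\<Sum>l\<in>{1..h}. \<Sum>K\<in>?K l. \<Sum>m\<le>n. ?s l K n (2 * m + Suc l mod 2))"
      by (intro sum.cong refl sum.swap)
    finally show ?thesis .
  qed
  moreover have "has_mean (\<lambda>n. \<Sum>l\<in>{1..h}. \<Sum>K\<in>?K l. \<Sum>m\<le>n. ?s l K n (2 * m + Suc l mod 2))
      (\<Sum>l\<in>{1..h}. \<Sum>K\<in>?K l. window_beta (h - l) (card (odd_window l)) / 2)"
  proof (intro has_mean_sum has_mean_odd_window)
    fix l i assume "i \<in> odd_window l"
    then show "odd (Suc l mod 2 + i)" by (simp add: odd_window_def)
  qed (auto simp: odd_window_def)
  moreover have "(\<Sum>l\<in>{1..h}. \<Sum>K\<in>?K l. window_beta (h - l) (card (odd_window l)) / 2) = hook_a_limit h"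
  proof -
    have "(\<Sum>K\<in>?K l. window_beta (h - l) (card (odd_window l)) / 2) = 1 / real (h - l div 2) / 2" if "l \<in> {1..h}" for l
    proof -
      let ?k = "(l - 1) div 2"
      have "finite (odd_window l)" "l \<notin> odd_window l" by (auto simp: odd_window_def)
      \<comment> \<open>Multisets of size \<open>h - l\<close> over \<open>?k + 1\<close> elements.
        This number cancels the factorials in \<open>window_beta\<close> and leaves
        \<open>1 / (h - l + ?k + 1)\<close>.\<close>
      then have "card (?K l) = (h - l + ?k) choose (h - l)"
        by (simp add: card_multisets_of_size card_odd_window add.commute)
      moreover have "h - l + ?k + 1 = h - l div 2"
      proof -
        have "1 \<le> l \<Longrightarrow> l div 2 + (l - 1) div 2 + 1 = l" by presburger
        then show ?thesis using that by auto
      qed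
      ultimately show ?thesis using binomial_window_beta[of "h - l" ?k]
        by (simp add: card_odd_window)
    qed
    then show ?thesis unfolding hook_a_limit_def sum_divide_distrib by (intro sum.cong) auto
  qed
  ultimately show ?thesis by simp
qed

section \<open>The limits\<close>

definition alt_harm :: "nat \<Rightarrow> real" where
  "alt_harm n = (\<Sum>k<n. (-1) ^ k / real (Suc k))"

lemma hook_a_limit_Suc: "hook_a_limit (Suc k) = (alt_harm (Suc k) + alt_harm k) / 2"
proof -
  define s where "s h = (\<Sum>i<h. 1 / real (h - Suc i div 2))" for h
  have s: "hook_a_limit h = s h / 2" for h
    unfolding hook_a_limit_def s_def
    by (intro arg_cong2[of _ _ 2 2 "(/)"] refl sum.reindex_bij_witness[where i = Suc and j = "\<lambda>l. l - 1"]) auto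
  have "s (Suc k) = alt_harm (Suc k) + alt_harm k"
  proof (induction k)
    case 0
    then show ?case by (simp add: s_def alt_harm_def)
  next
    case (Suc k)
    \<comment> \<open>The terms shared by \<open>s (Suc k)\<close> and
      \<open>s (Suc (Suc k))\<close>: the former has one more term at the end, the latter two more
      in front.\<close>
    let ?S = "\<Sum>i<k. 1 / real (Suc k - Suc i div 2)"
    have "s (Suc (Suc k)) = 1 / (k + 2) + (1 / (k + 1) + ?S)"
      unfolding s_def by (simp only: sum.lessThan_Suc_shift) simp
    moreover have "s (Suc k) = ?S + 1 / real (Suc k - Suc k div 2)"
      by (simp add: s_def)
    moreover have "1 / (k + 2) + 1 / (k + 1) - 1 / real (Suc k - Suc k div 2) =
        (-1) ^ k / (k + 1) + (-1) ^ Suc k / real (k + 2)"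
    proof (cases "even k")
      case True
      then obtain r where "k = 2 * r" by (rule evenE)
      moreover from this have "Suc k - Suc k div 2 = Suc r" by simp
      ultimately show ?thesis by (simp add: divide_simps) (simp add: algebra_simps)
    next
      case False
      then obtain r where "k = 2 * r + 1" by (rule oddE)
      moreover from this have "Suc k - Suc k div 2 = Suc r" by simp
      ultimately show ?thesis by (simp add: divide_simps) (simp add: algebra_simps)
    qed
    ultimately show ?case using Suc.IH by (simp add: alt_harm_def add.commute)
  qed
  then show ?thesis by (simp add: s)
qed

lemma hook_a_limit_diff:
  "hook_a_limit (Suc (Suc k)) - hook_a_limit (Suc k) =
     (-1) ^ k * (1 / real (k + 1) - 1 / real (k + 2)) / 2"
proof -
  have "alt_harm (Suc (Suc k)) - alt_harm k = (-1) ^ k * (1 / real (k + 1) - 1 / real (k + 2))"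
    by (simp add: alt_harm_def right_diff_distrib add.commute)
  then show ?thesis by (simp add: hook_a_limit_Suc diff_divide_distrib[symmetric])
qed

lemma hook_a_limit_tendsto: "hook_a_limit \<longlonglongrightarrow> ln 2"
proof -
  have "alt_harm \<longlonglongrightarrow> ln 2"
    using alternating_harmonic_series_sums by (simp add: sums_def alt_harm_def[abs_def])
  moreover from this have "(\<lambda>k. alt_harm (Suc k)) \<longlonglongrightarrow> ln 2" by (rule LIMSEQ_Suc)
  ultimately have "(\<lambda>k. (alt_harm (Suc k) + alt_harm k) / 2) \<longlonglongrightarrow> (ln 2 + ln 2) / 2"
    by (intro tendsto_intros) auto
  then have "(\<lambda>k. hook_a_limit (Suc k)) \<longlonglongrightarrow> ln 2" by (simp add: hook_a_limit_Suc)
  then show ?thesis by (rule LIMSEQ_imp_Suc)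
qed

text \<open>By \<open>hook_a_limit_diff\<close> the steps alternate in sign and shrink. So the
  values at odd \<open>h \<ge> 3\<close> never fall below \<open>hook_a_limit 3 = 2 / 3\<close>, and
  each value at an even \<open>h \<ge> 2\<close> is at least the next odd one.\<close>

lemma hook_a_limit_ge:
  assumes "h \<ge> 2"
  shows "hook_a_limit h \<ge> 2 / 3"
proof -
  have idx: "2 * r + 3 = Suc (Suc (Suc (2 * r)))" "2 * r + 4 = Suc (Suc (Suc (Suc (2 * r))))" for r :: nat
    by simp_all
  have odd: "hook_a_limit (2 * r + 3) \<ge> 2 / 3" for r
  proof (induction r)
    case 0
    show ?case using hook_a_limit_Suc[of 2]
      by (simp add: alt_harm_def numeral_3_eq_3 numeral_2_eq_2)
  next
    case (Suc r)
    let ?k = "real (2 * r)"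
    have "hook_a_limit (2 * r + 4) - hook_a_limit (2 * r + 3) = (1 / (?k + 3) - 1 / (?k + 4)) / 2"
      unfolding idx using hook_a_limit_diff[of "Suc (Suc (2 * r))"] by (simp add: add.commute)
    moreover have "hook_a_limit (2 * Suc r + 3) - hook_a_limit (2 * r + 4) = - (1 / (?k + 4) - 1 / (?k + 5)) / 2"
      unfolding idx using hook_a_limit_diff[of "Suc (Suc (Suc (2 * r)))"] by (simp add: add.commute)
    moreover have "1 / (?k + 3) - 1 / (?k + 4) \<ge> 1 / (?k + 4) - 1 / (?k + 5)"
    proof -
      have "1 / (?k + 3) - 1 / (?k + 4) = 1 / ((?k + 3) * (?k + 4))"
        "1 / (?k + 4) - 1 / (?k + 5) = 1 / ((?k + 4) * (?k + 5))" by (simp_all add: field_simps)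
      moreover have "1 / ((?k + 4) * (?k + 5)) \<le> 1 / ((?k + 3) * (?k + 4))"
      proof (intro divide_left_mono mult_pos_pos)
        show "(?k + 3) * (?k + 4) \<le> (?k + 4) * (?k + 5)" by (simp add: algebra_simps)
      qed (simp_all add: add_nonneg_pos)
      ultimately show ?thesis by simp
    qed
    ultimately show ?case using Suc by argo
  qed
  show ?thesis
  proof (cases "even h")
    case True
    define r where "r = (h - 2) div 2"
    have h: "h = 2 * r + 2" using True assms by (auto simp: r_def)
    have eq: "hook_a_limit (2 * r + 3) - hook_a_limit (2 * r + 2) = - (1 / real (2 * r + 2) - 1 / real (2 * r + 3)) / 2"
      unfolding idx using hook_a_limit_diff[of "Suc (2 * r)"] by (simp add: add.commute)
    have "1 / real (2 * r + 3) \<le> 1 / real (2 * r + 2)" by (intro divide_left_mono) auto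
    then have "hook_a_limit (2 * r + 3) - hook_a_limit (2 * r + 2) \<le> 0" unfolding eq by simp
    then show ?thesis using order_trans[OF odd] h by simp
  next
    case False
    define r where "r = (h - 3) div 2"
    have "h = 2 * r + 3" using False assms unfolding r_def by presburger
    then show ?thesis using odd[of r] by simp
  qed
qed

section \<open>Distinct-part limits as integrals\<close>

text \<open>Pascal's rule gives the recurrence
  \<open>v (n + 2) = y * v (n + 1) + x * y * v n\<close>. As \<open>y = 1 - x * y\<close>, its
  characteristic roots are \<open>1\<close> and \<open>- (x * y)\<close>, which together with the
  initial values explains the closed form.\<close>

lemma sum_diagonal_binomial:
  fixes x y :: "'a :: comm_ring_1"
  assumes "y = 1 - x * y"
  shows "(1 + x * y) * (\<Sum>i\<le>n. of_nat (i choose (n - i)) * x ^ (n - i) * y ^ i) = 1 - (- (x * y)) ^ Suc n"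
proof -
  define v where "v n = (\<Sum>i\<le>n. of_nat (i choose (n - i)) * x ^ (n - i) * y ^ i)" for n
  have rec: "v (Suc (Suc n)) = y * v (Suc n) + x * y * v n" for n
  proof -
    have "v (Suc (Suc n)) = (\<Sum>i\<le>n. of_nat (Suc i choose (Suc n - i)) * x ^ (Suc n - i) * y ^ Suc i) + y ^ Suc (Suc n)"
      unfolding v_def by (subst sum.atMost_Suc_shift) simp
    also have "(\<Sum>i\<le>n. of_nat (Suc i choose (Suc n - i)) * x ^ (Suc n - i) * y ^ Suc i) =
        (\<Sum>i\<le>n. y * (of_nat (i choose (Suc n - i)) * x ^ (Suc n - i) * y ^ i) +
           x * y * (of_nat (i choose (n - i)) * x ^ (n - i) * y ^ i))"
      by (intro sum.cong refl) (simp add: Suc_diff_le algebra_simps)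
    also have "\<dots> = y * (\<Sum>i\<le>n. of_nat (i choose (Suc n - i)) * x ^ (Suc n - i) * y ^ i) + x * y * v n"
      by (simp only: sum.distrib sum_distrib_left v_def)
    finally show ?thesis by (simp add: v_def algebra_simps)
  qed
  have "(1 + x * y) * v n = 1 - (- (x * y)) ^ Suc n"
  proof (induction n rule: induct_nat_012)
    case 0
    show ?case by (simp add: v_def)
  next
    case 1
    define z where "z = x * y"
    have y: "y = 1 - z" using assms by (simp add: z_def)
    have "v (Suc 0) = y" by (simp add: v_def)
    then have "v (Suc 0) = 1 - z" using y by (rule trans)
    then show ?case unfolding z_def[symmetric] by (simp only:) (simp add: algebra_simps)
  next
    case (ge2 n)
    define z where "z = x * y"
    have y: "y = 1 - z" using assms by (simp add: z_def)
    have "(1 + z) * v (Suc (Suc n)) = y * ((1 + z) * v (Suc n)) + z * ((1 + z) * v n)"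
      by (simp add: rec z_def algebra_simps)
    also have "\<dots> = (1 - z) * (1 - (- z) ^ Suc (Suc n)) + z * (1 - (- z) ^ Suc n)"
      using ge2 unfolding z_def[symmetric] by (simp only: y)
    also have "\<dots> = 1 - (- z) ^ Suc (Suc (Suc n))" by (simp add: algebra_simps)
    finally show ?case by (simp add: z_def)
  qed
  then show ?thesis by (simp only: v_def)
qed

text \<open>The sum is moved under the integral and evaluated by
  \<open>sum_diagonal_binomial\<close> with \<open>y = 1 / (1 + x)\<close>, for which
  \<open>1 + x * y = (1 + 2 * x) * y\<close>.\<close>

lemma hook_b_limit_has_integral:
  assumes "h > 0"
  shows "((\<lambda>x. (1 - (- (x / (1 + x))) ^ h) / (1 + 2 * x)) has_integral hook_b_limit h) {0..1}"
proof -
  have int: "((\<lambda>x. \<Sum>l\<in>{1..h}. real ((l - 1) choose (h - l)) * (x ^ (h - l) / (1 + x) ^ l)) has_integral hook_b_limit h) {0..1}"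
    unfolding hook_b_limit_def window_integral_def
    by (intro has_integral_sum has_integral_mult_right integrable_integral window_integrable) auto
  have eq: "(\<Sum>l\<in>{1..h}. real ((l - 1) choose (h - l)) * (x ^ (h - l) / (1 + x) ^ l)) =
      (1 - (- (x / (1 + x))) ^ h) / (1 + 2 * x)" if "x \<in> {0..1}" for x :: real
  proof -
    obtain n where h: "h = Suc n" using assms by (cases h) auto
    define y where "y = 1 / (1 + x)"
    have x: "x \<ge> 0" "1 + x \<noteq> 0" "1 + 2 * x \<noteq> 0" using that by auto
    have y: "y = 1 - x * y" "x * y = x / (1 + x)" using x by (simp_all add: y_def field_simps)
    let ?v = "\<Sum>i\<le>n. real (i choose (n - i)) * x ^ (n - i) * y ^ i"
    have "(\<Sum>l\<in>{1..h}. real ((l - 1) choose (h - l)) * (x ^ (h - l) / (1 + x) ^ l)) = y * ?v"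
      unfolding sum_distrib_left h One_nat_def sum.atLeast1_atMost_eq lessThan_Suc_atMost
      by (intro sum.cong refl) (simp add: y_def power_one_over)
    moreover have "(1 + 2 * x) * (y * ?v) = 1 - (- (x / (1 + x))) ^ h"
    proof -
      have "1 + x * y = (1 + 2 * x) * y" using x by (simp add: y_def field_simps)
      then have "(1 + 2 * x) * (y * ?v) = (1 + x * y) * ?v" by (simp only: mult.assoc)
      also have "\<dots> = 1 - (- (x / (1 + x))) ^ h"
        unfolding h y(2)[symmetric] by (rule sum_diagonal_binomial[OF y(1)])
      finally show ?thesis .
    qed
    ultimately show ?thesis using x(3) by (metis nonzero_mult_div_cancel_left)
  qed
  show ?thesis by (rule has_integral_eq[OF eq int])
qed

lemma has_integral_inverse_1_2x: "((\<lambda>x. c / (1 + 2 * x)) has_integral c * (ln 3 / 2)) {0..1::real}"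
proof -
  have "((\<lambda>x. c / (1 + 2 * x)) has_integral c / 2 * ln (1 + 2 * 1) - c / 2 * ln (1 + 2 * 0)) {0..1::real}"
  proof (rule fundamental_theorem_of_calculus)
    fix x :: real assume "x \<in> {0..1}"
    then have "1 + 2 * x > 0" by simp
    then have "((\<lambda>x. ln (1 + 2 * x)) has_real_derivative 2 / (1 + 2 * x)) (at x within {0..1})"
      by (auto intro!: derivative_eq_intros)
    from DERIV_cmult[OF this, of "c / 2"]
    show "((\<lambda>x. c / 2 * ln (1 + 2 * x)) has_vector_derivative c / (1 + 2 * x)) (at x within {0..1})"
      by (simp only: has_real_derivative_iff_has_vector_derivative) simp
  qed simp
  then show ?thesis by simp
qed

lemma odds_power_bounds:
  assumes "x \<in> {0..1::real}"
  shows "0 \<le> (x / (1 + x)) ^ h" "(x / (1 + x)) ^ h \<le> (1 / 2) ^ h"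
proof -
  have "0 \<le> x / (1 + x)" "x / (1 + x) \<le> 1 / 2" using assms by (auto simp: field_simps)
  then show "0 \<le> (x / (1 + x)) ^ h" "(x / (1 + x)) ^ h \<le> (1 / 2) ^ h"
    by (auto intro: power_mono simp del: power_divide simp add: zero_le_power)
qed

text \<open>Since \<open>x / (1 + x)\<close> lies between \<open>0\<close> and \<open>1 / 2\<close>,
  the numerator differs from \<open>1\<close> by at most \<open>(1 / 2) ^ h\<close>, while
  \<open>1 / (1 + 2 * x)\<close> integrates to \<open>ln 3 / 2\<close>.\<close>

lemma hook_b_limit_bounds:
  assumes "h > 0"
  shows "hook_b_limit h \<le> (1 + (1 / 2) ^ h) * (ln 3 / 2)" "hook_b_limit h \<ge> (1 - (1 / 2) ^ h) * (ln 3 / 2)"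
proof -
  have abs: "\<bar>(- (x / (1 + x))) ^ h\<bar> \<le> (1 / 2) ^ h" if "x \<in> {0..1}" for x :: real
    using odds_power_bounds[OF that, of h] that by (simp add: power_abs)
  show "hook_b_limit h \<le> (1 + (1 / 2) ^ h) * (ln 3 / 2)"
  proof (rule has_integral_le[OF hook_b_limit_has_integral[OF assms] has_integral_inverse_1_2x])
    fix x :: real assume x: "x \<in> {0..1}"
    have "1 - (- (x / (1 + x))) ^ h \<le> 1 + (1 / 2) ^ h" using abs[OF x] by linarith
    then show "(1 - (- (x / (1 + x))) ^ h) / (1 + 2 * x) \<le> (1 + (1 / 2) ^ h) / (1 + 2 * x)"
      using x by (intro divide_right_mono) auto
  qed
  show "(1 - (1 / 2) ^ h) * (ln 3 / 2) \<le> hook_b_limit h"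
  proof (rule has_integral_le[OF has_integral_inverse_1_2x hook_b_limit_has_integral[OF assms]])
    fix x :: real assume x: "x \<in> {0..1}"
    have "1 - (1 / 2) ^ h \<le> 1 - (- (x / (1 + x))) ^ h" using abs[OF x] by linarith
    then show "(1 - (1 / 2) ^ h) / (1 + 2 * x) \<le> (1 - (- (x / (1 + x))) ^ h) / (1 + 2 * x)"
      using x by (intro divide_right_mono) auto
  qed
qed

text \<open>Uses \<open>3 ^ 5 = 243 < 256 = 2 ^ 8\<close> and
  \<open>ln 2 \<le> 25 / 36\<close>.\<close>

lemma ln_3_le: "ln (3 :: real) \<le> 10 / 9"
proof -
  have "5 * ln (3 :: real) = ln (3 ^ 5)" by (simp only: ln_realpow)
  also have "\<dots> \<le> ln (2 ^ 8)" by (rule ln_mono) auto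
  also have "\<dots> = 8 * ln 2" by (simp only: ln_realpow)
  finally show ?thesis using ln2_le_25_over_36 by simp
qed

text \<open>For even \<open>h\<close> the numerator is at most \<open>1\<close>; an odd
  \<open>h\<close> is at least \<open>3\<close>, and the numerator is at most
  \<open>1 + 1 / 8\<close>. This gives the bound
  \<open>9 / 16 * ln 3 \<le> 5 / 8 < 2 / 3\<close>.\<close>

lemma hook_b_limit_less:
  assumes "h \<ge> 2"
  shows "hook_b_limit h < 2 / 3"
proof -
  have "hook_b_limit h \<le> 9 / 8 * (ln 3 / 2)"
  proof (rule has_integral_le[OF hook_b_limit_has_integral has_integral_inverse_1_2x])
    fix x :: real assume x: "x \<in> {0..1}"
    have "- ((- (x / (1 + x))) ^ h) \<le> 1 / 8"
    proof (cases "even h")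
      case True
      then show ?thesis using zero_le_even_power[OF True, of "- (x / (1 + x))"] by linarith
    next
      case False
      then have "h \<ge> 3" using assms by presburger
      then have "(1 / 2 :: real) ^ h \<le> (1 / 2) ^ 3" by (intro power_decreasing) auto
      then show ?thesis using odds_power_bounds(2)[OF x, of h] False by (simp add: power3_eq_cube)
    qed
    then show "(1 - (- (x / (1 + x))) ^ h) / (1 + 2 * x) \<le> 9 / 8 / (1 + 2 * x)"
      using x by (intro divide_right_mono) auto
  qed (use assms in simp)
  then show ?thesis using ln_3_le by simp
qed

lemma hook_b_limit_pos:
  assumes "h > 0"
  shows "hook_b_limit h > 0"
proof -
  have "(1 / 2 :: real) ^ h < 1" using assms by (simp add: power_less_one_iff)
  then have "0 < (1 - (1 / 2) ^ h) * (ln 3 / 2 :: real)" by (intro mult_pos_pos) auto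
  then show ?thesis using hook_b_limit_bounds(2)[OF assms] by linarith
qed

lemma hook_b_limit_tendsto: "hook_b_limit \<longlonglongrightarrow> ln 3 / 2"
proof (rule tendsto_sandwich)
  have half: "(\<lambda>h. (1 / 2 :: real) ^ h) \<longlonglongrightarrow> 0" by (rule LIMSEQ_power_zero) simp
  have "(\<lambda>h. (1 - (1 / 2) ^ h) * (ln 3 / 2)) \<longlonglongrightarrow> (1 - 0) * (ln 3 / 2 :: real)"
    by (intro tendsto_intros half)
  then show "(\<lambda>h. (1 - (1 / 2) ^ h) * (ln 3 / 2)) \<longlonglongrightarrow> (ln 3 / 2 :: real)" by simp
  have "(\<lambda>h. (1 + (1 / 2) ^ h) * (ln 3 / 2)) \<longlonglongrightarrow> (1 + 0) * (ln 3 / 2 :: real)"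
    by (intro tendsto_intros half)
  then show "(\<lambda>h. (1 + (1 / 2) ^ h) * (ln 3 / 2)) \<longlonglongrightarrow> (ln 3 / 2 :: real)" by simp
  show "\<forall>\<^sub>F h in sequentially. (1 - (1 / 2) ^ h) * (ln 3 / 2) \<le> hook_b_limit h"
    using hook_b_limit_bounds(2) by (auto intro: eventually_mono[OF eventually_gt_at_top[of 0]])
  show "\<forall>\<^sub>F h in sequentially. hook_b_limit h \<le> (1 + (1 / 2) ^ h) * (ln 3 / 2)"
    using hook_b_limit_bounds(1) by (auto intro: eventually_mono[OF eventually_gt_at_top[of 0]])
qed

section \<open>Quotients of hook counts and their limits\<close>

lemma hook_ratio_tendsto:
  assumes "h > 0"
  shows "(\<lambda>n. real (hook_a h n) / real (hook_b h n)) \<longlonglongrightarrow> hook_a_limit h / hook_b_limit h"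
proof -
  have "(\<lambda>n. (real (hook_a h n) / strict_sum n) / (real (hook_b h n) / strict_sum n)) \<longlonglongrightarrow>
      hook_a_limit h / hook_b_limit h"
    using has_mean_hook_a has_mean_hook_b hook_b_limit_pos[OF assms] unfolding has_mean_def
    by (intro tendsto_divide) auto
  moreover have "strict_sum n \<noteq> 0" for n using strict_sum_pos[of n] by simp
  ultimately show ?thesis by simp
qed

lemma hook_gamma_eq: "h > 0 \<Longrightarrow> hook_gamma h = hook_a_limit h / hook_b_limit h"
  unfolding hook_gamma_def by (intro limI hook_ratio_tendsto)

theorem theorem1p6:
  "(\<forall>h\<ge>2. (\<lambda>n. real (hook_a h n) / real (hook_b h n)) \<longlonglongrightarrow> hook_gamma h \<and> hook_gamma h > 1) \<and>
   hook_gamma \<longlonglongrightarrow> ln 4 / ln 3"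
proof (intro conjI allI impI)
  fix h :: nat assume h: "h \<ge> 2"
  then show "(\<lambda>n. real (hook_a h n) / real (hook_b h n)) \<longlonglongrightarrow> hook_gamma h"
    using hook_ratio_tendsto[of h] by (simp add: hook_gamma_eq)
  have "hook_b_limit h < hook_a_limit h"
    using hook_a_limit_ge[OF h] hook_b_limit_less[OF h] by linarith
  then show "hook_gamma h > 1"
    using h hook_b_limit_pos[of h] by (simp add: hook_gamma_eq)
next
  have "(\<lambda>h. hook_a_limit h / hook_b_limit h) \<longlonglongrightarrow> ln 2 / (ln 3 / 2)"
    by (intro tendsto_divide hook_a_limit_tendsto hook_b_limit_tendsto) simp
  also have "ln 2 / (ln 3 / 2) = ln 4 / (ln 3 :: real)"
    using ln_realpow[of 2 2] by simp
  finally have "(\<lambda>h. hook_a_limit h / hook_b_limit h) \<longlonglongrightarrow> ln 4 / ln 3" .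
  \<comment> \<open>\<open>hook_gamma_eq\<close> assumes \<open>h > 0\<close>, so the two sequences
    are compared only eventually.\<close>
  moreover have "\<forall>\<^sub>F h in sequentially. hook_a_limit h / hook_b_limit h = hook_gamma h"
    by (auto intro!: eventually_mono[OF eventually_gt_at_top[of 0]] simp: hook_gamma_eq)
  ultimately show "hook_gamma \<longlonglongrightarrow> ln 4 / ln 3" by (rule Lim_transform_eventually)
qed

end
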